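(* Let $r\in[0,2]$, and let $N\ge1$ and $m$ be integers with $0\le m\le N+1$. Let $a<b$ be real, $h=(b-a)/2$ and $k>0$. Then, when $|f|_{H^m_w[a,b]}<\infty$, $$\left|I_k^{[a,b]}(f)-I_{k,N}^{[a,b]}(f)\right|\ \le\ \sigma'_{m,N}\left(\frac1k\right)^r h^{m+1-r}\left(\frac1N\right)^{m-\rho(r)}|f|_{H^m_w[a,b]},$$ where $\sigma'_{m,N}=C\,\sigma_{m,N}$ with a constant $C$ independent of $m$ and $N$.
   Context: $I_k^{[a,b]}(f)=\int_a^b f(x)\exp(\mathrm{i}kx)\,\mathrm{d}x$ for a function $f$ on $[a,b]$. Filon-Clenshaw-Curtis (FCC) rule on $[-1,1]$: for $N\ge1$ let $Q_Nf$ be the algebraic polynomial of degree at most $N$ interpolating $f$ at $t_{j,N}=\cos(j\pi/N)$, $j=0,\dots,N$. For $k\ge 1/2$, $I_{k,N}(f)=\int_{-1}^1 (Q_Nf)(x)\exp(\mathrm{i}kx)\,\mathrm{d}x$. For $0<k<1/2$, $I_{k,N}(f)=\int_{-1}^1 (Q_Nf_k)(x)\,\mathrm{d}x$ with $f_k(x)=f(x)\exp(\mathrm{i}kx)$. FCC rule on $[a,b]$: with $c=(a+b)/2$, $h=(b-a)/2$, $\tilde k=hk$ and $\tilde f(t)=f(c+ht)$, $t\in[-1,1]$, set $I_{k,N}^{[a,b]}(f)=h\exp(\mathrm{i}kc)\,I_{\tilde k,N}(\tilde f)$. $\rho(r)=r$ for $r\in[0,1]$ and $\rho(r)=\frac52r-\frac32$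 for $r\in[1,2]$. Weighted seminorm: $|f|_{H^m_w[a,b]}=\left\{\int_a^b\frac{|f^{(m)}(x)|^2}{\sqrt{(b-x)(x-a)}}\,\mathrm{d}x\right\}^{1/2}$, with $f^{(m)}$ the $m$-th derivative. The constants $\sigma'_{m,N}$ are the same as those in the corresponding bound on $[-1,1]$, namely $|I_k(f)-I_{k,N}(f)|\le\sigma'_{m,N}k^{-r}N^{-(m-\rho(r))}|f|_{H^m_w[-1,1]}$ with $I_k=I_k^{[-1,1]}$; they do not depend on $a$, $b$, $k$ or $f$. The constants $\sigma_{m,N}>0$, $0\le m\le N+1$, are those in the bound $\|(I-\mathcal S_N)f_c\|_{H^m}\le\sigma_{m,N}\|(f^{(m)})_c\|_{H^0}$ for functions $f$ on $[-1,1]$, where $g_c(\theta)=g(\cos\theta)$, $\mathcal S_N$ is truncation of the Fourier series on $[-\pi,\pi]$ to frequencies $|\mu|\le N$, and $\|\varphi\|_{H^m}^2=|\widehat\varphi(0)|^2+\sum_{\mu\ne0}|\mu|^{2m}|\widehat\varphi(\mu)|^2$ with $\widehat\varphi(\mu)=\frac1{2\pi}\int_{-\pi}^{\pi}\varphi(\theta)e^{-\mathrm{i}\mu\theta}\,\mathrm{d}\theta$. For $m\ge1$, $\sigma_{m,N}=\prod_{j=1}^{m-1}\frac{N+1}{N+1-j}$ (empty product equal to $1$); for $m=0$ the bound holds trivially with constant $1$, since $\mathcal S_N$ is an orthogonal projection on $H^0$.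
   Formalization: The bound with σ' = Cσ is proved only for m ≥ 1, r ≤ m and hk ≥ 1/2, as it fails otherwise (e.g. f = 1 with hk < 1/2; spikes for m = 0; f = exp(-ikx)/k for m = 1 < r). For all m, r, k, a constant valid on [-1,1] at wave number hk is shown to carry over to [a,b]. *)

theory Defs
  imports "HOL-Analysis.Analysis" "HOL-Computational_Algebra.Polynomial"
begin

definition osc_integral :: "real \<Rightarrow> real \<Rightarrow> real \<Rightarrow> (real \<Rightarrow> complex) \<Rightarrow> complex" where
  "osc_integral a b k f = integral {a..b} (\<lambda>x. f x * exp (\<i> * of_real (k * x)))"

definition cc_node :: "nat \<Rightarrow> nat \<Rightarrow> real" where
  "cc_node N j = cos (real j * pi / real N)"

text \<open>For \<open>N \<ge> 1\<close> the nodes are distinct, so the interpolating polynomial exists and is unique.\<close>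

definition cc_interp :: "nat \<Rightarrow> (real \<Rightarrow> complex) \<Rightarrow> complex poly" where
  "cc_interp N f = (THE p. degree p \<le> N \<and>
     (\<forall>j\<le>N. poly p (of_real (cc_node N j)) = f (cc_node N j)))"

definition fcc_ref :: "real \<Rightarrow> nat \<Rightarrow> (real \<Rightarrow> complex) \<Rightarrow> complex" where
  "fcc_ref k N f =
     (if k \<ge> 1/2
      then integral {-1..1} (\<lambda>x. poly (cc_interp N f) (of_real x) * exp (\<i> * of_real (k * x)))
      else integral {-1..1}
             (\<lambda>x. poly (cc_interp N (\<lambda>y. f y * exp (\<i> * of_real (k * y)))) (of_real x)))"

definition fcc :: "real \<Rightarrow> real \<Rightarrow> real \<Rightarrow> nat \<Rightarrow> (real \<Rightarrow> complex) \<Rightarrow> complex" where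
  "fcc a b k N f =
     (let c = (a + b) / 2; h = (b - a) / 2
      in of_real h * exp (\<i> * of_real (k * c)) * fcc_ref (h * k) N (\<lambda>t. f (c + h * t)))"

definition rho :: "real \<Rightarrow> real" where
  "rho r = (if r \<le> 1 then r else 5/2 * r - 3/2)"

definition fcc_sigma :: "nat \<Rightarrow> nat \<Rightarrow> real" where
  "fcc_sigma m N = (\<Prod>j = 1..m - 1. (real N + 1) / (real N + 1 - real j))"

text \<open>\<open>is_deriv a b m f g\<close>: the function \<open>g\<close> is an \<open>m\<close>-th derivative of \<open>f\<close> on \<open>[a,b]\<close> in the
  Sobolev sense. A function has an integrable first derivative precisely when it is an indefinite
  Lebesgue integral, i.e. is absolutely continuous. For \<open>m \<ge> 1\<close> the function \<open>g\<close> is determined by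
  \<open>f\<close> up to a null set. Since the quadrature rule evaluates \<open>f\<close> pointwise, \<open>f\<close> itself is not
  taken modulo null sets.\<close>

fun is_deriv :: "real \<Rightarrow> real \<Rightarrow> nat \<Rightarrow> (real \<Rightarrow> complex) \<Rightarrow> (real \<Rightarrow> complex) \<Rightarrow> bool" where
  "is_deriv a b 0 f g \<longleftrightarrow> (\<forall>x\<in>{a..b}. f x = g x)"
| "is_deriv a b (Suc m) f g \<longleftrightarrow>
     (\<exists>f'. f' absolutely_integrable_on {a..b} \<and>
           (\<forall>x\<in>{a..b}. f x = f a + integral {a..x} f') \<and>
           is_deriv a b m f' g)"

definition nth_derivative :: "real \<Rightarrow> real \<Rightarrow> nat \<Rightarrow> (real \<Rightarrow> complex) \<Rightarrow> real \<Rightarrow> complex" where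
  "nth_derivative a b m f = (SOME g. is_deriv a b m f g)"

definition Hw_integrand :: "real \<Rightarrow> real \<Rightarrow> nat \<Rightarrow> (real \<Rightarrow> complex) \<Rightarrow> real \<Rightarrow> real" where
  "Hw_integrand a b m f x = (norm (nth_derivative a b m f x))\<^sup>2 / sqrt ((b - x) * (x - a))"

text \<open>The seminorm is meaningful (and finite) exactly on the space \<open>Hw a b m\<close>; elsewhere
  \<^const>\<open>integral\<close> may return the default value \<open>0\<close>.\<close>

definition Hw :: "real \<Rightarrow> real \<Rightarrow> nat \<Rightarrow> (real \<Rightarrow> complex) set" where
  "Hw a b m = {f. (\<exists>g. is_deriv a b m f g) \<and>
                  nth_derivative a b m f \<in> borel_measurable (lebesgue_on {a..b}) \<and>
                  Hw_integrand a b m f integrable_on {a..b}}"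

definition Hw_seminorm :: "real \<Rightarrow> real \<Rightarrow> nat \<Rightarrow> (real \<Rightarrow> complex) \<Rightarrow> real" where
  "Hw_seminorm a b m f = sqrt (integral {a..b} (Hw_integrand a b m f))"

text \<open>The error bound on the reference interval \<open>[-1,1]\<close>, with constant \<open>s\<close>, at a single wave
  number \<open>k\<close>.\<close>

definition fcc_ref_bound :: "real \<Rightarrow> nat \<Rightarrow> nat \<Rightarrow> real \<Rightarrow> real \<Rightarrow> bool" where
  "fcc_ref_bound r m N k s \<longleftrightarrow>
     (\<forall>f \<in> Hw (-1) 1 m.
        norm (osc_integral (-1) 1 k f - fcc_ref k N f)
          \<le> s * (1 / k) powr r * (1 / real N) powr (real m - rho r) * Hw_seminorm (-1) 1 m f)"

end

theory Submission
  imports Defs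
begin

text \<open>After the substitution \<open>x = cos t\<close> the weighted norm of \<open>g\<close> is the plain \<open>L\<^sup>2\<close> norm of
  \<open>g \<circ> cos\<close> on \<open>[0, \<pi>]\<close>, polynomials of degree at most \<open>N\<close> are the cosine sums with frequencies
  up to \<open>N\<close>, and the nodes are the equispaced points \<open>j \<pi> / N\<close>. The proof of the bound on
  \<open>[-1, 1]\<close> for \<open>k \<ge> 1/2\<close> has two ingredients there.

  The first is approximation. If \<open>\<phi>\<close> has derivative \<open>\<psi>\<close>, then the partial cosine sum of \<open>\<phi>\<close> with
  frequencies below \<open>M\<close> misses \<open>\<phi>\<close> by at most \<open>1/M\<close> times the norm of \<open>\<psi>\<close>
  (\<open>cos_approximation\<close>). Subtracting from \<open>f\<close> a primitive of an approximation to \<open>f'\<close> and repeating,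
  one collects the factors \<open>1/M\<close>, \<open>1/(M-1)\<close>, and so on from the successive derivatives
  (\<open>cos_chain_approximation\<close>); the product of these factors is what \<open>\<sigma>\<close> measures against a power of
  \<open>N\<close> (\<open>fcc_sigma_ge\<close>).

  The second is stability: the derivative of the cosine interpolant is bounded in \<open>L\<^sup>2\<close> by the
  derivative of the interpolated function (\<open>interpolation_stability\<close>), because the increments between
  nodes are shared and a discrete Parseval identity recovers the coefficients from them. Interpolation
  reproduces a polynomial \<open>P\<close> of degree \<open>N\<close>, so \<open>f\<close> may be replaced by \<open>f - P\<close> where \<open>P'\<close> is the
  approximation to \<open>f'\<close> just obtained. With \<open>D\<close> the resulting bound for the norm of \<open>f' - P'\<close>, the
  error \<open>E\<close> vanishes at the nodes and its derivative in \<open>t\<close> is of size \<open>D\<close>. Hence the oscillatory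
  integral of \<open>E\<close> is at most a constant times \<open>D/N\<close> (no integration by parts, zeros at distance
  \<open>\<pi>/N\<close>), \<open>D/k\<close> (one), and, when \<open>f\<close> has a second derivative, \<open>N powr (5/2) * D / k\<^sup>2\<close> (two);
  see \<open>interpolation_error_integrals\<close>. The function \<open>\<rho>\<close> is the piecewise linear interpolation of the
  exponents of \<open>N\<close> at \<open>r = 0, 1, 2\<close>, and the bound for real \<open>r\<close> is a geometric mean of two
  neighbouring ones (\<open>fcc_ref_bound_explicit\<close>).

  The passage to \<open>[a, b]\<close> is scaling: the error gains a factor \<open>h\<close>, the wave number becomes \<open>h k\<close>
  and the seminorm gains \<open>h ^ m\<close> (\<open>fcc_error_affine\<close>, \<open>Hw_affine\<close>). Since derivatives are selected
  by a choice operator, this uses that they are unique up to a null set (\<open>is_deriv_unique\<close>).\<close>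

section \<open>Absolutely continuous functions\<close>

text \<open>Absolute continuity of \<open>\<phi>\<close> with derivative \<open>\<psi>\<close>, in the integrated form in which Sobolev
  derivatives are defined.\<close>

definition is_primitive :: "real \<Rightarrow> real \<Rightarrow> (real \<Rightarrow> complex) \<Rightarrow> (real \<Rightarrow> complex) \<Rightarrow> bool" where
  "is_primitive a b \<phi> \<psi> \<longleftrightarrow>
     \<psi> absolutely_integrable_on {a..b} \<and> (\<forall>x\<in>{a..b}. \<phi> x = \<phi> a + integral {a..x} \<psi>)"

lemma is_primitiveD:
  assumes "is_primitive a b \<phi> \<psi>"
  shows "\<psi> absolutely_integrable_on {a..b}"
    and "x \<in> {a..b} \<Longrightarrow> \<phi> x = \<phi> a + integral {a..x} \<psi>"
  using assms unfolding is_primitive_def by blast+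

lemma is_primitive_integrable_sub:
  assumes "is_primitive a b \<phi> \<psi>" "a \<le> x" "y \<le> b"
  shows "\<psi> absolutely_integrable_on {x..y}" "\<psi> integrable_on {x..y}"
    "(\<lambda>t. norm (\<psi> t)) integrable_on {x..y}"
proof -
  show 1: "\<psi> absolutely_integrable_on {x..y}"
    using is_primitiveD(1)[OF assms(1)] assms(2,3) by (auto intro: absolutely_integrable_on_subinterval)
  show "\<psi> integrable_on {x..y}" "(\<lambda>t. norm (\<psi> t)) integrable_on {x..y}"
    using 1 by (auto simp: absolutely_integrable_on_def)
qed

lemma is_primitive_increment:
  assumes "is_primitive a b \<phi> \<psi>" "a \<le> x" "x \<le> y" "y \<le> b"
  shows "\<phi> y - \<phi> x = integral {x..y} \<psi>"
    and "norm (\<phi> y - \<phi> x) \<le> integral {x..y} (\<lambda>t. norm (\<psi> t))"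
proof -
  have "integral {a..x} \<psi> + integral {x..y} \<psi> = integral {a..y} \<psi>"
    using assms is_primitive_integrable_sub(2)[OF assms(1), of a y] by (intro Henstock_Kurzweil_Integration.integral_combine) auto
  moreover have "\<phi> y = \<phi> a + integral {a..y} \<psi>" "\<phi> x = \<phi> a + integral {a..x} \<psi>"
    using assms(2-4) by (auto intro!: is_primitiveD(2)[OF assms(1)])
  ultimately show eq: "\<phi> y - \<phi> x = integral {x..y} \<psi>"
    by (simp add: algebra_simps)
  show "norm (\<phi> y - \<phi> x) \<le> integral {x..y} (\<lambda>t. norm (\<psi> t))"
    unfolding eq using is_primitive_integrable_sub[OF assms(1), of x y] assms
    by (intro integral_norm_bound_integral) auto
qed

lemma is_primitive_continuous:
  assumes "is_primitive a b \<phi> \<psi>"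
  shows "continuous_on {a..b} \<phi>"
proof (cases "a \<le> b")
  case True
  have "continuous_on {a..b} (\<lambda>x. \<phi> a + integral {a..x} \<psi>)"
    using is_primitive_integrable_sub(2)[OF assms, of a b]
    by (intro continuous_intros indefinite_integral_continuous_1) auto
  thus ?thesis
    by (rule continuous_on_eq) (rule is_primitiveD(2)[OF assms, symmetric])
qed auto

lemma is_primitive_C1:
  assumes "\<And>x. x \<in> {a..b} \<Longrightarrow> (v has_vector_derivative v' x) (at x within {a..b})"
    and "continuous_on {a..b} v'"
  shows "is_primitive a b v v'"
  unfolding is_primitive_def
proof safe
  show "v' absolutely_integrable_on {a..b}"
    using assms(2) by (rule absolutely_integrable_continuous_real)
  fix x assume x: "x \<in> {a..b}"
  have "(v' has_integral v x - v a) {a..x}"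
    using x assms(1) by (intro fundamental_theorem_of_calculus)
      (auto intro: has_vector_derivative_within_subset[where S="{a..b}"])
  thus "v x = v a + integral {a..x} v'"
    by (simp add: integral_unique)
qed

lemma is_primitive_diff:
  assumes "is_primitive a b \<phi> \<psi>" "is_primitive a b \<phi>' \<psi>'"
  shows "is_primitive a b (\<lambda>x. \<phi> x - \<phi>' x) (\<lambda>x. \<psi> x - \<psi>' x)"
  unfolding is_primitive_def
proof safe
  show "(\<lambda>x. \<psi> x - \<psi>' x) absolutely_integrable_on {a..b}"
    by (intro set_integral_diff is_primitiveD(1)[OF assms(1)] is_primitiveD(1)[OF assms(2)])
  fix x assume "x \<in> {a..b}"
  with is_primitive_integrable_sub(2)[OF assms(1), of a x] is_primitive_integrable_sub(2)[OF assms(2), of a x]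
    is_primitive_increment(1)[OF assms(1), of a x] is_primitive_increment(1)[OF assms(2), of a x]
  show "\<phi> x - \<phi>' x = \<phi> a - \<phi>' a + integral {a..x} (\<lambda>x. \<psi> x - \<psi>' x)"
    by (simp add: Henstock_Kurzweil_Integration.integral_diff algebra_simps)
qed

lemma is_primitive_cong:
  assumes "is_primitive a b \<phi> \<psi>" "\<And>x. x \<in> {a..b} \<Longrightarrow> \<phi>' x = \<phi> x" "\<And>x. x \<in> {a..b} \<Longrightarrow> \<psi>' x = \<psi> x"
  shows "is_primitive a b \<phi>' \<psi>'"
proof -
  have "\<psi>' absolutely_integrable_on {a..b}"
    using is_primitiveD(1)[OF assms(1)] assms(3) by (auto intro: absolutely_integrable_spike[where S="{}"])
  moreover have "integral {a..x} \<psi>' = integral {a..x} \<psi>" if "x \<in> {a..b}" for x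
    using that assms by (intro integral_cong) auto
  ultimately show ?thesis
    unfolding is_primitive_def
    using is_primitiveD(2)[OF assms(1)] assms(2) by (metis atLeastAtMost_iff order.refl order_trans)
qed

lemma absolutely_integrable_continuous_mult:
  fixes v \<psi> :: "real \<Rightarrow> complex"
  assumes "continuous_on {a..b} v" "\<psi> absolutely_integrable_on {a..b}"
  shows "(\<lambda>x. v x * \<psi> x) absolutely_integrable_on {a..b}"
proof (rule absolutely_integrable_bounded_measurable_product[OF bilinear_times])
  show "v \<in> borel_measurable (lebesgue_on {a..b})"
    by (intro continuous_imp_measurable_on_sets_lebesgue assms) auto
  show "bounded (v ` {a..b})"
    by (intro compact_imp_bounded compact_continuous_image assms) auto
qed (use assms in auto)

text \<open>The defect between \<open>\<phi>v\<close> and the sum of the two indefinite integrals has increments at most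
  \<open>2M(y - x)(J y - J x)\<close>, where \<open>M\<close> bounds \<open>v'\<close> and \<open>J\<close> is the indefinite integral of
  \<open>norm \<psi>\<close>. As \<open>J\<close> is continuous, the defect has derivative zero everywhere.\<close>

lemma is_primitive_by_parts:
  assumes p: "is_primitive a b \<phi> \<psi>" and ab: "a \<le> b"
    and v: "\<And>x. x \<in> {a..b} \<Longrightarrow> (v has_vector_derivative v' x) (at x within {a..b})"
    and v': "continuous_on {a..b} v'"
  shows "integral {a..b} (\<lambda>x. \<phi> x * v' x) =
           \<phi> b * v b - \<phi> a * v a - integral {a..b} (\<lambda>x. \<psi> x * v x)"
proof -
  have cphi: "continuous_on {a..b} \<phi>" using is_primitive_continuous[OF p] .
  have pv: "is_primitive a b v v'" using is_primitive_C1[OF v v'] .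
  have cv: "continuous_on {a..b} v" using is_primitive_continuous[OF pv] .
  have i1: "(\<lambda>x. \<phi> x * v' x) integrable_on {a..b}"
    by (intro integrable_continuous_real continuous_intros cphi v')
  have "(\<lambda>x. v x * \<psi> x) absolutely_integrable_on {a..b}"
    by (intro absolutely_integrable_continuous_mult cv is_primitiveD(1)[OF p])
  hence i2: "(\<lambda>x. \<psi> x * v x) integrable_on {a..b}"
    by (simp add: absolutely_integrable_on_def mult.commute)
  define J where "J = (\<lambda>x. integral {a..x} (\<lambda>t. norm (\<psi> t)))"
  define I where "I = (\<lambda>x. integral {a..x} (\<lambda>x. \<phi> x * v' x) + integral {a..x} (\<lambda>x. \<psi> x * v x) - \<phi> x * v x)"
  obtain M where M: "M > 0" "\<And>x. x \<in> {a..b} \<Longrightarrow> norm (v' x) \<le> M"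
  proof -
    have "bounded (v' ` {a..b})"
      by (intro compact_imp_bounded compact_continuous_image v') auto
    thus ?thesis using that unfolding bounded_pos by auto
  qed
  have cJ: "continuous_on {a..b} J"
    unfolding J_def using is_primitive_integrable_sub(3)[OF p, of a b]
    by (intro indefinite_integral_continuous_1) auto
  have key: "norm (I y - I x) \<le> 2 * M * (y - x) * (J y - J x)" if "a \<le> x" "x \<le> y" "y \<le> b" for x y
  proof -
    have J: "J y - J x = integral {x..y} (\<lambda>t. norm (\<psi> t))"
      using Henstock_Kurzweil_Integration.integral_combine[of a x y "\<lambda>t. norm (\<psi> t)"] that is_primitive_integrable_sub(3)[OF p, of a y]
      by (auto simp: J_def algebra_simps)
    have j1: "(\<lambda>x. \<phi> x * v' x) integrable_on {a..y}" "(\<lambda>x. \<psi> x * v x) integrable_on {a..y}"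
       "(\<lambda>x. \<phi> x * v' x) integrable_on {x..y}" "(\<lambda>x. \<psi> x * v x) integrable_on {x..y}"
      by (rule integrable_on_subinterval[OF i1] integrable_on_subinterval[OF i2]; use that in force)+
    have v'xy: "v' integrable_on {x..y}"
      using that by (intro is_primitive_integrable_sub(2)[OF pv]) auto
    note psixy = is_primitive_integrable_sub[OF p \<open>a \<le> x\<close> \<open>y \<le> b\<close>]
    have "I y - I x = integral {x..y} (\<lambda>x. \<phi> x * v' x) + integral {x..y} (\<lambda>x. \<psi> x * v x) 
            - (\<phi> y * v y - \<phi> x * v x)"
      using Henstock_Kurzweil_Integration.integral_combine[OF that(1,2) j1(1)] Henstock_Kurzweil_Integration.integral_combine[OF that(1,2) j1(2)]
      by (simp add: I_def algebra_simps)
    also have "\<phi> y * v y - \<phi> x * v x = \<phi> x * (v y - v x) + (\<phi> y - \<phi> x) * v y"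
      by (simp add: algebra_simps)
    also have "\<dots> = integral {x..y} (\<lambda>t. \<phi> x * v' t) + integral {x..y} (\<lambda>t. \<psi> t * v y)"
      using is_primitive_increment(1)[OF p that] is_primitive_increment(1)[OF pv that] by simp
    also have "integral {x..y} (\<lambda>x. \<phi> x * v' x) + integral {x..y} (\<lambda>x. \<psi> x * v x) - \<dots> =
       integral {x..y} (\<lambda>t. (\<phi> t * v' t - \<phi> x * v' t) + (\<psi> t * v t - \<psi> t * v y))"
      using j1 v'xy psixy
      by (subst Henstock_Kurzweil_Integration.integral_add)
         (auto intro!: Henstock_Kurzweil_Integration.integrable_diff 
            simp: Henstock_Kurzweil_Integration.integral_diff integrable_on_mult_left integrable_on_mult_right)
    also have "norm \<dots> \<le> integral {x..y} (\<lambda>t. M * (J y - J x) + norm (\<psi> t) * (M * (y - x)))"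
    proof (intro integral_norm_bound_integral)
      show "(\<lambda>t. (\<phi> t * v' t - \<phi> x * v' t) + (\<psi> t * v t - \<psi> t * v y)) integrable_on {x..y}"
        using j1 v'xy psixy
        by (intro Henstock_Kurzweil_Integration.integrable_add Henstock_Kurzweil_Integration.integrable_diff)
          (auto simp: integrable_on_mult_left integrable_on_mult_right)
      show "(\<lambda>t. M * (J y - J x) + norm (\<psi> t) * (M * (y - x))) integrable_on {x..y}"
        using psixy by (intro Henstock_Kurzweil_Integration.integrable_add) 
           (auto simp: integrable_on_mult_left)
      fix t assume t: "t \<in> {x..y}"
      have "norm (\<phi> t - \<phi> x) \<le> integral {x..t} (\<lambda>t. norm (\<psi> t))"
        using is_primitive_increment(2)[OF p, of x t] t that by auto
      also have "\<dots> \<le> integral {x..y} (\<lambda>t. norm (\<psi> t))"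
        using t that by (intro integral_subset_le is_primitive_integrable_sub(3)[OF p]) auto
      finally have 1: "norm (\<phi> t - \<phi> x) \<le> J y - J x" by (simp add: J)
      have "norm (v y - v t) \<le> integral {t..y} (\<lambda>t. norm (v' t))"
        using is_primitive_increment(2)[OF pv, of t y] t that by auto
      also have "\<dots> \<le> integral {t..y} (\<lambda>_. M)"
        using t that M by (intro integral_le is_primitive_integrable_sub(3)[OF pv]) auto
      also have "\<dots> \<le> M * (y - x)" using t M by (auto simp: mult.commute)
      finally have 2: "norm (v y - v t) \<le> M * (y - x)" .
      have "norm ((\<phi> t * v' t - \<phi> x * v' t) + (\<psi> t * v t - \<psi> t * v y)) 
             \<le> norm ((\<phi> t - \<phi> x) * v' t) + norm (\<psi> t * (v y - v t))"
        using norm_triangle_ineq4[of "(\<phi> t - \<phi> x) * v' t" "\<psi> t * (v y - v t)"] by (simp add: algebra_simps)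
      also have "\<dots> \<le> (J y - J x) * M + norm (\<psi> t) * (M * (y - x))"
        unfolding norm_mult using 1 2 M(1) M(2)[of t] t that order_trans[OF norm_ge_zero 1]
        by (intro add_mono mult_mono) auto
      finally show "norm ((\<phi> t * v' t - \<phi> x * v' t) + (\<psi> t * v t - \<psi> t * v y)) 
           \<le> M * (J y - J x) + norm (\<psi> t) * (M * (y - x))" by (simp add: mult.commute)
    qed
    also have "\<dots> = 2 * M * (y - x) * (J y - J x)"
      using psixy that by (subst Henstock_Kurzweil_Integration.integral_add)
         (auto simp: J integrable_on_mult_left)
    finally show ?thesis .
  qed
  have "(I has_vector_derivative 0) (at x within {a..b})" if x: "x \<in> {a..b}" for x
  proof -
    have lim: "((\<lambda>y. 2 * M * \<bar>J y - J x\<bar>) \<longlongrightarrow> 2 * M * \<bar>J x - J x\<bar>) (at x within {a..b})"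
      using cJ x by (intro tendsto_intros) (auto simp: continuous_on)
    have "((\<lambda>y. (I y - I x) /\<^sub>R (y - x)) \<longlongrightarrow> 0) (at x within {a..b})"
    proof (rule Lim_null_comparison[OF _ lim[simplified]])
      show "\<forall>\<^sub>F y in at x within {a..b}. norm ((I y - I x) /\<^sub>R (y - x)) \<le> 2 * M * \<bar>J y - J x\<bar>"
        unfolding eventually_at_topological
      proof (intro exI[of _ UNIV] conjI ballI impI; (simp; fail)?)
        fix y assume y: "y \<noteq> x" "y \<in> {a..b}"
        have "norm (I y - I x) \<le> 2 * M * \<bar>y - x\<bar> * \<bar>J y - J x\<bar>"
        proof (cases "x \<le> y")
          case True
          have "2 * M * (y - x) * (J y - J x) \<le> 2 * M * \<bar>y - x\<bar> * \<bar>J y - J x\<bar>"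
            using M True by (simp add: mult_left_mono)
          thus ?thesis using key[of x y] True x y by auto
        next
          case False
          have "2 * M * (x - y) * (J x - J y) \<le> 2 * M * \<bar>y - x\<bar> * \<bar>J y - J x\<bar>"
            using M False by (simp add: mult_left_mono)
          thus ?thesis using key[of y x] False x y by (auto simp: norm_minus_commute)
        qed
        thus "norm ((I y - I x) /\<^sub>R (y - x)) \<le> 2 * M * \<bar>J y - J x\<bar>"
          using y unfolding norm_scaleR by (simp add: divide_simps) (simp add: mult_ac)
      qed
    qed
    thus ?thesis
      unfolding has_vector_derivative_def has_derivative_within
      by (simp add: bounded_linear_zero divide_inverse_commute Lim_within)
  qed
  then obtain c where c: "\<And>x. x \<in> {a..b} \<Longrightarrow> I x = c"
    using has_vector_derivative_zero_constant[of "{a..b}" I] by auto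
  have "I b = I a" using c ab by auto
  thus ?thesis by (simp add: I_def algebra_simps)
qed

text \<open>Henstock's lemma turns vanishing of all interval integrals into a vanishing integral of the
  absolute value.\<close>

lemma vanishing_indefinite_integral_imp_negligible:
  fixes h :: "real \<Rightarrow> complex"
  assumes "h integrable_on {a..b}" "\<And>x. x \<in> {a..b} \<Longrightarrow> integral {a..x} h = 0"
  shows "negligible {x \<in> {a..b}. h x \<noteq> 0}"
proof -
  have sub0: "integral {c..d} h = 0" if "{c..d} \<subseteq> {a..b}" "c \<le> d" for c d
    using Henstock_Kurzweil_Integration.integral_combine[of a c d h] assms(2)[of c] assms(2)[of d] that
      integrable_on_subinterval[OF assms(1), of a d] by auto
  have "((\<lambda>x. norm (h x)) has_integral 0) (cbox a b)"
    unfolding has_integral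
  proof safe
    fix e :: real assume "e > 0"
    then obtain \<gamma> where g: "gauge \<gamma>" 
      "\<And>p. \<lbrakk>p tagged_partial_division_of (cbox a b); \<gamma> fine p\<rbrakk> \<Longrightarrow>
             sum (\<lambda>(x,k). norm(measure lborel k *\<^sub>R h x - integral k h)) p < e"
      using Henstock_lemma[of h a b e] assms by auto
    have "norm ((\<Sum>(x, k)\<in>D. measure lborel k *\<^sub>R cmod (h x)) - 0) < e"
      if D: "D tagged_division_of cbox a b" "\<gamma> fine D" for D
    proof -
      have "(\<Sum>(x, k)\<in>D. measure lborel k *\<^sub>R cmod (h x)) = sum (\<lambda>(x,k). norm(measure lborel k *\<^sub>R h x - integral k h)) D"
      proof (rule sum.cong[OF refl], clarify)
        fix x k assume xk: "(x, k) \<in> D"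
        then obtain c d where k: "k = {c..d}" "k \<subseteq> {a..b}" "c \<le> d"
          using tagged_division_ofD(2,3,4)[OF D(1) xk]
          by (metis atLeastatMost_empty_iff2 box_real(2) empty_iff)
        thus "measure lborel k *\<^sub>R cmod (h x) = norm (measure lborel k *\<^sub>R h x - integral k h)"
          using sub0[of c d] by simp
      qed
      also have "\<dots> < e" using that g(2) by (auto simp: tagged_division_of_def)
      finally show ?thesis
        by (subst diff_0_right, subst real_norm_def, subst abs_of_nonneg) (auto intro!: sum_nonneg)
    qed
    note small = this
    show "\<exists>\<gamma>. gauge \<gamma> \<and> (\<forall>\<D>. \<D> tagged_division_of cbox a b \<and> \<gamma> fine \<D> \<longrightarrow> 
       norm ((\<Sum>(x, k)\<in>\<D>. measure lborel k *\<^sub>R cmod (h x)) - 0) < e)"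
      by (intro exI[of _ \<gamma>] conjI allI impI g(1) small) (elim conjE, assumption)+
  qed
  hence i0: "((\<lambda>x. norm (h x)) has_integral 0) {a..b}" by simp
  have 1: "set_integrable lebesgue {a..b} (\<lambda>x. norm (h x))"
    by (rule nonnegative_absolutely_integrable_1[OF has_integral_integrable[OF i0]]) simp
  have "set_lebesgue_integral lebesgue {a..b} (\<lambda>x. norm (h x)) = 0"
    using set_lebesgue_integral_eq_integral(2)[OF 1] i0 by (simp add: integral_unique)
  hence "AE x in lebesgue. indicat_real {a..b} x *\<^sub>R norm (h x) = 0"
    using 1 unfolding set_lebesgue_integral_def set_integrable_def
    by (subst (asm) integral_nonneg_eq_0_iff_AE) auto
  then have "negligible {x. \<not> (indicat_real {a..b} x *\<^sub>R norm (h x) = 0)}"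
    by (simp add: completion.AE_iff_null_sets negligible_iff_null_sets)
  thus ?thesis
    by (rule negligible_subset) (auto simp: indicator_def)
qed

section \<open>Square-integrable functions and orthogonal expansions\<close>

definition sq_int :: "real \<Rightarrow> real \<Rightarrow> (real \<Rightarrow> complex) \<Rightarrow> bool" where
  "sq_int a b \<phi> \<longleftrightarrow> \<phi> \<in> borel_measurable (lebesgue_on {a..b}) \<and> (\<lambda>t. (norm (\<phi> t))\<^sup>2) integrable_on {a..b}"

definition nsq :: "real \<Rightarrow> real \<Rightarrow> (real \<Rightarrow> complex) \<Rightarrow> real" where
  "nsq a b \<phi> = integral {a..b} (\<lambda>t. (norm (\<phi> t))\<^sup>2)"

lemma nsq_nonneg: "0 \<le> nsq a b \<phi>"
  unfolding nsq_def
  by (cases "(\<lambda>t. (norm (\<phi> t))\<^sup>2) integrable_on {a..b}")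
     (auto intro: integral_nonneg simp: not_integrable_integral)

lemma sq_int_mult:
  assumes "sq_int a b \<phi>" "sq_int a b \<psi>"
  shows "(\<lambda>t. \<phi> t * \<psi> t) absolutely_integrable_on {a..b}"
proof (rule measurable_bounded_by_integrable_imp_absolutely_integrable)
  show "(\<lambda>t. \<phi> t * \<psi> t) \<in> borel_measurable (lebesgue_on {a..b})"
    using assms by (intro borel_measurable_times) (auto simp: sq_int_def)
  show "(\<lambda>t. (norm (\<phi> t))\<^sup>2 + (norm (\<psi> t))\<^sup>2) integrable_on {a..b}"
    using assms by (intro Henstock_Kurzweil_Integration.integrable_add) (auto simp: sq_int_def)
  fix t
  have "0 \<le> (norm (\<phi> t) - norm (\<psi> t))\<^sup>2" "0 \<le> (norm (\<phi> t))\<^sup>2 + (norm (\<psi> t))\<^sup>2" by auto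
  thus "norm (\<phi> t * \<psi> t) \<le> (norm (\<phi> t))\<^sup>2 + (norm (\<psi> t))\<^sup>2"
    unfolding norm_mult power2_diff by linarith
qed auto

lemma sq_int_continuous:
  assumes "continuous_on {a..b} v"
  shows "sq_int a b v"
  unfolding sq_int_def
  by (intro conjI continuous_imp_measurable_on_sets_lebesgue integrable_continuous_real continuous_intros assms) auto

lemma sq_int_absolutely_integrable:
  assumes "sq_int a b \<phi>"
  shows "\<phi> absolutely_integrable_on {a..b}"
  using sq_int_mult[OF assms sq_int_continuous[of a b "\<lambda>_. 1"]] by simp

lemma sq_int_bound:
  assumes "g \<in> borel_measurable (lebesgue_on {a..b})" "h integrable_on {a..b}"
    "\<And>t. t \<in> {a..b} \<Longrightarrow> (norm (g t))\<^sup>2 \<le> h t"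
  shows "sq_int a b g"
  unfolding sq_int_def
proof (intro conjI assms(1))
  show "(\<lambda>t. (norm (g t))\<^sup>2) integrable_on {a..b}"
    by (rule measurable_bounded_by_integrable_imp_integrable[OF _ assms(2)])
       (use assms in \<open>auto intro!: borel_measurable_power borel_measurable_norm\<close>)
qed

lemma norm_diff_sq_le: "(norm (x - y :: complex))\<^sup>2 \<le> 2 * (norm x)\<^sup>2 + 2 * (norm y)\<^sup>2"
proof -
  have "(norm (x - y))\<^sup>2 \<le> (norm x + norm y)\<^sup>2"
    by (intro power_mono norm_triangle_ineq4) auto
  also have "\<dots> \<le> 2 * (norm x)\<^sup>2 + 2 * (norm y)\<^sup>2"
    using zero_le_power2[of "norm x - norm y"] by (simp add: power2_eq_square algebra_simps)
  finally show ?thesis .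
qed

lemma sq_int_diff:
  assumes "sq_int a b \<phi>" "sq_int a b \<psi>"
  shows "sq_int a b (\<lambda>t. \<phi> t - \<psi> t)" "nsq a b (\<lambda>t. \<phi> t - \<psi> t) \<le> 2 * nsq a b \<phi> + 2 * nsq a b \<psi>"
proof -
  have i: "(\<lambda>t. 2 * (norm (\<phi> t))\<^sup>2 + 2 * (norm (\<psi> t))\<^sup>2) integrable_on {a..b}"
    using assms by (intro Henstock_Kurzweil_Integration.integrable_add integrable_on_mult_right) (auto simp: sq_int_def)
  show 1: "sq_int a b (\<lambda>t. \<phi> t - \<psi> t)"
    using assms by (intro sq_int_bound[OF _ i] norm_diff_sq_le borel_measurable_diff) (auto simp: sq_int_def)
  have "nsq a b (\<lambda>t. \<phi> t - \<psi> t) \<le> integral {a..b} (\<lambda>t. 2 * (norm (\<phi> t))\<^sup>2 + 2 * (norm (\<psi> t))\<^sup>2)"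
    unfolding nsq_def using 1 i by (intro integral_le norm_diff_sq_le) (auto simp: sq_int_def)
  also have "\<dots> = 2 * nsq a b \<phi> + 2 * nsq a b \<psi>"
    unfolding nsq_def using assms
    by (subst Henstock_Kurzweil_Integration.integral_add) (auto simp: sq_int_def intro: integrable_on_mult_right)
  finally show "nsq a b (\<lambda>t. \<phi> t - \<psi> t) \<le> 2 * nsq a b \<phi> + 2 * nsq a b \<psi>" .
qed

lemma sq_int_mult_bounded:
  assumes "sq_int a b \<phi>" "continuous_on {a..b} v" "\<And>t. t \<in> {a..b} \<Longrightarrow> norm (v t) \<le> 1"
  shows "sq_int a b (\<lambda>t. v t * \<phi> t)" "nsq a b (\<lambda>t. v t * \<phi> t) \<le> nsq a b \<phi>"
proof -
  have le: "(norm (v t * \<phi> t))\<^sup>2 \<le> (norm (\<phi> t))\<^sup>2" if "t \<in> {a..b}" for t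
    unfolding norm_mult using assms(3)[OF that] by (intro power_mono mult_left_le_one_le) auto
  have i: "(\<lambda>t. (norm (\<phi> t))\<^sup>2) integrable_on {a..b}" using assms by (simp add: sq_int_def)
  have m: "(\<lambda>t. v t * \<phi> t) \<in> borel_measurable (lebesgue_on {a..b})"
    using assms(1) by (intro borel_measurable_times continuous_imp_measurable_on_sets_lebesgue[OF assms(2)]) 
      (auto simp: sq_int_def)
  show 1: "sq_int a b (\<lambda>t. v t * \<phi> t)" by (rule sq_int_bound[OF m i le])
  show "nsq a b (\<lambda>t. v t * \<phi> t) \<le> nsq a b \<phi>"
    unfolding nsq_def using 1 i le by (intro integral_le) (auto simp: sq_int_def)
qed

lemma sq_int_subinterval:
  assumes "sq_int a b \<phi>" "a \<le> x" "y \<le> b"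
  shows "sq_int x y \<phi>"
proof -
  have 1: "\<phi> \<in> borel_measurable (lebesgue_on {x..y})"
    using assms by (auto simp: sq_int_def intro: measurable_restrict_mono[where A="{a..b}"])
  thus ?thesis using assms unfolding sq_int_def
    by (auto intro: integrable_on_subinterval)
qed

text \<open>Cauchy-Schwarz against the constant function: the square of the distance from \<open>norm \<phi>\<close> to
  its mean is integrated.\<close>

lemma integral_norm_sq_le:
  assumes "sq_int a b \<phi>" "a \<le> b"
  shows "(integral {a..b} (\<lambda>t. norm (\<phi> t)))\<^sup>2 \<le> (b - a) * nsq a b \<phi>"
proof (cases "a = b")
  case False
  define A where "A = integral {a..b} (\<lambda>t. norm (\<phi> t))"
  define s where "s = A / (b - a)"
  have i: "(\<lambda>t. norm (\<phi> t)) integrable_on {a..b}" "(\<lambda>t. (norm (\<phi> t))\<^sup>2) integrable_on {a..b}"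
    using sq_int_absolutely_integrable[OF assms(1)] assms by (auto simp: absolutely_integrable_on_def sq_int_def)
  have "((\<lambda>t. s\<^sup>2 - 2 * s * norm (\<phi> t) + (norm (\<phi> t))\<^sup>2) has_integral 
           (b - a) * s\<^sup>2 - 2 * s * A + nsq a b \<phi>) {a..b}"
    using has_integral_const_real[of "s\<^sup>2" a b] integrable_integral[OF i(1)] integrable_integral[OF i(2)] assms(2)
    unfolding A_def nsq_def
    by (intro has_integral_add has_integral_diff has_integral_mult_right) auto
  moreover have "s\<^sup>2 - 2 * s * norm (\<phi> t) + (norm (\<phi> t))\<^sup>2 \<ge> 0" for t
    using zero_le_power2[of "s - norm (\<phi> t)"] by (simp add: power2_diff)
  ultimately have "0 \<le> (b - a) * s\<^sup>2 - 2 * s * A + nsq a b \<phi>"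
    by (rule has_integral_nonneg)
  also have "\<dots> = nsq a b \<phi> - A\<^sup>2 / (b - a)"
    using False unfolding s_def by (simp add: power2_eq_square)
  finally show ?thesis
    using False assms(2) unfolding A_def[symmetric] by (simp add: divide_le_eq mult.commute)
qed (auto simp: nsq_def)

lemma integral_norm_le_sqrt:
  assumes "sq_int a b \<phi>" "a \<le> b"
  shows "integral {a..b} (\<lambda>t. norm (\<phi> t)) \<le> sqrt ((b - a) * nsq a b \<phi>)"
  using integral_norm_sq_le[OF assms] by (rule real_le_rsqrt)

text \<open>Completing the square. Taking all \<open>\<beta> n\<close> equal to the Fourier coefficients shows that the
  partial sum is the best approximation; the left-hand side being nonnegative is Bessel's inequality.\<close>

lemma orthogonal_expansion:
  fixes e :: "'i \<Rightarrow> real \<Rightarrow> real" and \<Lambda> :: "'i \<Rightarrow> real" and \<phi> :: "real \<Rightarrow> complex"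
  assumes fin: "finite A" and \<phi>: "sq_int a b \<phi>" 
    and cont: "\<And>n. n \<in> A \<Longrightarrow> continuous_on {a..b} (e n)"
    and orth: "\<And>n m. n \<in> A \<Longrightarrow> m \<in> A \<Longrightarrow> 
         ((\<lambda>t. e n t * e m t) has_integral (if n = m then \<Lambda> n else 0)) {a..b}"
    and c: "\<And>n. n \<in> A \<Longrightarrow> integral {a..b} (\<lambda>t. \<phi> t * of_real (e n t)) = of_real (\<Lambda> n) * c n"
  shows "nsq a b (\<lambda>t. \<phi> t - (\<Sum>n\<in>A. \<beta> n * of_real (e n t))) =
           nsq a b \<phi> - (\<Sum>n\<in>A. \<Lambda> n * (norm (c n))\<^sup>2) + (\<Sum>n\<in>A. \<Lambda> n * (norm (\<beta> n - c n))\<^sup>2)"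
proof -
  have ce: "continuous_on {a..b} (\<lambda>t. complex_of_real (e n t))" if "n \<in> A" for n
    using cont[OF that] by (intro continuous_intros)
  have sq: "sq_int a b (\<lambda>t. \<phi> t - (\<Sum>n\<in>A. \<beta> n * of_real (e n t)))"
    by (intro sq_int_diff \<phi> sq_int_continuous continuous_intros ce)
  have 0: "((\<lambda>t. of_real ((norm (\<phi> t))\<^sup>2) :: complex) has_integral of_real (nsq a b \<phi>)) {a..b}"
    using \<phi> unfolding nsq_def sq_int_def by (intro has_integral_of_real integrable_integral) auto
  have 1: "((\<lambda>t. \<phi> t * of_real (e n t)) has_integral of_real (\<Lambda> n) * c n) {a..b}" if "n \<in> A" for n
    using sq_int_mult[OF \<phi> sq_int_continuous[OF ce[OF that]]] c[OF that]
    by (metis absolutely_integrable_on_def integrable_integral)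
  have 2: "((\<lambda>t. cnj (\<phi> t) * of_real (e n t)) has_integral of_real (\<Lambda> n) * cnj (c n)) {a..b}" if "n \<in> A" for n
    using has_integral_linear[OF 1[OF that] bounded_linear_cnj] by (simp add: o_def)
  have 3: "((\<lambda>t. complex_of_real (e n t * e m t)) has_integral of_real (if n = m then \<Lambda> n else 0)) {a..b}" 
     if "n \<in> A" "m \<in> A" for n m
    using orth[OF that] by (rule has_integral_of_real)
  have "((\<lambda>t. of_real ((norm (\<phi> t))\<^sup>2) - (\<Sum>n\<in>A. cnj (\<beta> n) * (\<phi> t * of_real (e n t)))
           - (\<Sum>n\<in>A. \<beta> n * (cnj (\<phi> t) * of_real (e n t))) 
           + (\<Sum>n\<in>A. \<Sum>m\<in>A. (\<beta> n * cnj (\<beta> m)) * of_real (e n t * e m t))) has_integral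
          of_real (nsq a b \<phi>) - (\<Sum>n\<in>A. cnj (\<beta> n) * (of_real (\<Lambda> n) * c n))
           - (\<Sum>n\<in>A. \<beta> n * (of_real (\<Lambda> n) * cnj (c n))) 
           + (\<Sum>n\<in>A. \<Sum>m\<in>A. (\<beta> n * cnj (\<beta> m)) * of_real (if n = m then \<Lambda> n else 0))) {a..b}"
    by (intro has_integral_add has_integral_diff has_integral_sum has_integral_mult_right fin 0 1 2 3)
  also have "(\<lambda>t. of_real ((norm (\<phi> t))\<^sup>2) - (\<Sum>n\<in>A. cnj (\<beta> n) * (\<phi> t * of_real (e n t)))
           - (\<Sum>n\<in>A. \<beta> n * (cnj (\<phi> t) * of_real (e n t))) 
           + (\<Sum>n\<in>A. \<Sum>m\<in>A. (\<beta> n * cnj (\<beta> m)) * of_real (e n t * e m t))) =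
      (\<lambda>t. of_real ((norm (\<phi> t - (\<Sum>n\<in>A. \<beta> n * of_real (e n t))))\<^sup>2))"
    by (rule ext) (simp add: complex_norm_square algebra_simps sum_distrib_left sum_distrib_right sum_product 
          del: of_real_power, subst sum.swap, simp add: mult_ac)
  also have "(\<Sum>n\<in>A. \<Sum>m\<in>A. (\<beta> n * cnj (\<beta> m)) * of_real (if n = m then \<Lambda> n else 0)) =
     (\<Sum>n\<in>A. of_real (\<Lambda> n) * (\<beta> n * cnj (\<beta> n)))"
    using fin by (intro sum.cong refl) (simp add: if_distrib if_distribR cong: if_cong)
  also have "of_real (nsq a b \<phi>) - (\<Sum>n\<in>A. cnj (\<beta> n) * (of_real (\<Lambda> n) * c n))
           - (\<Sum>n\<in>A. \<beta> n * (of_real (\<Lambda> n) * cnj (c n))) + (\<Sum>n\<in>A. of_real (\<Lambda> n) * (\<beta> n * cnj (\<beta> n)))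
       = of_real (nsq a b \<phi> - (\<Sum>n\<in>A. \<Lambda> n * (norm (c n))\<^sup>2) + (\<Sum>n\<in>A. \<Lambda> n * (norm (\<beta> n - c n))\<^sup>2))"
    by (simp add: complex_norm_square algebra_simps sum.distrib sum_subtractf del: of_real_power)
  finally have "((\<lambda>t. complex_of_real ((norm (\<phi> t - (\<Sum>n\<in>A. \<beta> n * of_real (e n t))))\<^sup>2)) has_integral
     of_real (nsq a b \<phi> - (\<Sum>n\<in>A. \<Lambda> n * (norm (c n))\<^sup>2) + (\<Sum>n\<in>A. \<Lambda> n * (norm (\<beta> n - c n))\<^sup>2))) {a..b}" .
  moreover have "((\<lambda>t. complex_of_real ((norm (\<phi> t - (\<Sum>n\<in>A. \<beta> n * of_real (e n t))))\<^sup>2)) has_integral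
     of_real (nsq a b (\<lambda>t. \<phi> t - (\<Sum>n\<in>A. \<beta> n * of_real (e n t))))) {a..b}"
    using sq unfolding nsq_def sq_int_def by (intro has_integral_of_real integrable_integral) auto
  ultimately have "complex_of_real (nsq a b (\<lambda>t. \<phi> t - (\<Sum>n\<in>A. \<beta> n * of_real (e n t)))) = 
     of_real (nsq a b \<phi> - (\<Sum>n\<in>A. \<Lambda> n * (norm (c n))\<^sup>2) + (\<Sum>n\<in>A. \<Lambda> n * (norm (\<beta> n - c n))\<^sup>2))"
    by (rule has_integral_unique[rotated])
  thus ?thesis unfolding of_real_eq_iff .
qed

lemma has_integral_cos_int:
  "((\<lambda>t. cos (of_int l * t)) has_integral (if l = 0 then pi else 0)) {0..pi}"
proof (cases "l = 0")
  case True
  thus ?thesis using has_integral_const_real[of "1::real" 0 pi] by simp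
next
  case False
  have "((\<lambda>t. cos (of_int l * t)) has_integral (sin (of_int l * pi) / of_int l - sin (of_int l * 0) / of_int l)) {0..pi}"
    using False by (intro fundamental_theorem_of_calculus)
      (auto simp flip: has_real_derivative_iff_has_vector_derivative intro!: derivative_eq_intros)
  moreover have "sin (of_int l * pi) = 0" by (simp add: sin_zero_iff_int2)
  ultimately show ?thesis using False by simp
qed

lemma cos_orthogonal:
  "((\<lambda>t. cos (real n * t) * cos (real m * t)) has_integral 
      (if n = m then (if n = 0 then pi else pi / 2) else 0)) {0..pi}"
proof -
  have eq: "cos (real n * t) * cos (real m * t) = 
     (cos (of_int (int n - int m) * t) + cos (of_int (int n + int m) * t)) / 2" for t
    by (simp add: cos_add cos_diff ring_distribs)
  have "((\<lambda>t. (cos (of_int (int n - int m) * t) + cos (of_int (int n + int m) * t)) / 2) has_integral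
      ((if int n - int m = 0 then pi else 0) + (if int n + int m = 0 then pi else 0)) / 2) {0..pi}"
    by (intro has_integral_divide has_integral_add has_integral_cos_int)
  thus ?thesis unfolding eq by (cases "n = 0"; cases "m = 0"; cases "n = m") simp_all
qed

lemma sin_orthogonal:
  assumes "0 < n" "0 < m"
  shows "((\<lambda>t. sin (real n * t) * sin (real m * t)) has_integral (if n = m then pi / 2 else 0)) {0..pi}"
proof -
  have eq: "sin (real n * t) * sin (real m * t) = 
     (cos (of_int (int n - int m) * t) - cos (of_int (int n + int m) * t)) / 2" for t
    by (simp add: cos_add cos_diff ring_distribs)
  have "((\<lambda>t. (cos (of_int (int n - int m) * t) - cos (of_int (int n + int m) * t)) / 2) has_integral
      ((if int n - int m = 0 then pi else 0) - (if int n + int m = 0 then pi else 0)) / 2) {0..pi}"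
    by (intro has_integral_divide has_integral_diff has_integral_cos_int)
  thus ?thesis unfolding eq using assms by (auto split: if_splits)
qed

section \<open>Cosine polynomials and a Wirtinger inequality\<close>

definition lin_combs :: "(nat \<Rightarrow> real \<Rightarrow> real) \<Rightarrow> nat \<Rightarrow> (real \<Rightarrow> complex) set" where
  "lin_combs e M = {f. \<exists>c. f = (\<lambda>t. \<Sum>n<M. c n * of_real (e n t))}"

lemma lin_combsI: "f = (\<lambda>t. \<Sum>n<M. c n * of_real (e n t)) \<Longrightarrow> f \<in> lin_combs e M"
  unfolding lin_combs_def mem_Collect_eq by (rule exI[of _ c])

lemma lin_combsE:
  assumes "f \<in> lin_combs e M"
  obtains c where "f = (\<lambda>t. \<Sum>n<M. c n * of_real (e n t))"
  using assms unfolding lin_combs_def mem_Collect_eq by (elim exE)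

lemma lin_combs_basis:
  assumes "n < M"
  shows "(\<lambda>t. c * of_real (e n t)) \<in> lin_combs e M"
proof -
  have "(\<lambda>t. c * of_real (e n t)) = (\<lambda>t. \<Sum>k<M. (if k = n then c else 0) * of_real (e k t))"
    using assms by (simp add: if_distrib if_distribR cong: if_cong)
  thus ?thesis by (rule lin_combsI)
qed

lemma lin_combs_add:
  assumes "f \<in> lin_combs e M" "g \<in> lin_combs e M"
  shows "(\<lambda>t. f t + g t) \<in> lin_combs e M"
proof -
  obtain c where "f = (\<lambda>t. \<Sum>n<M. c n * of_real (e n t))"
    using assms(1) by (rule lin_combsE)
  moreover obtain d where "g = (\<lambda>t. \<Sum>n<M. d n * of_real (e n t))"
    using assms(2) by (rule lin_combsE)
  ultimately have "(\<lambda>t. f t + g t) = (\<lambda>t. \<Sum>n<M. (c n + d n) * of_real (e n t))"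
    by (simp add: sum.distrib distrib_right)
  thus ?thesis by (rule lin_combsI)
qed

lemma lin_combs_zero: "(\<lambda>t. 0) \<in> lin_combs e M"
  by (rule lin_combsI[where c = "\<lambda>_. 0"]) simp

lemma lin_combs_sum:
  assumes "\<And>i. i \<in> I \<Longrightarrow> f i \<in> lin_combs e M"
  shows "(\<lambda>t. \<Sum>i\<in>I. f i t) \<in> lin_combs e M"
  using assms by (induction I rule: infinite_finite_induct) (auto intro: lin_combs_zero lin_combs_add)

lemma lin_combs_mono:
  assumes "f \<in> lin_combs e M" "M \<le> K"
  shows "f \<in> lin_combs e K"
proof -
  obtain c where "f = (\<lambda>t. \<Sum>n<M. c n * of_real (e n t))"
    using assms lin_combsE by blast
  moreover have "(\<lambda>t. \<Sum>n<M. c n * of_real (e n t)) \<in> lin_combs e K"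
    using assms(2) by (intro lin_combs_sum lin_combs_basis) auto
  ultimately show ?thesis by simp
qed

abbreviation cos_polys :: "nat \<Rightarrow> (real \<Rightarrow> complex) set" where
  "cos_polys \<equiv> lin_combs (\<lambda>n t. cos (real n * t))"

lemma cos_polys_mult_cos:
  assumes "f \<in> cos_polys M"
  shows "(\<lambda>t. of_real (cos t) * f t) \<in> cos_polys (Suc M)"
proof -
  obtain c where f: "f = (\<lambda>t. \<Sum>n<M. c n * of_real (cos (real n * t)))"
    using assms lin_combsE by blast
  have "(\<lambda>t. c n * of_real (cos t * cos (real n * t))) \<in> cos_polys (Suc M)" if "n < M" for n
  proof (cases n)
    case 0
    thus ?thesis using lin_combs_basis[of 1 "Suc M" "c n" "\<lambda>n t. cos (real n * t)"] that by simp
  next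
    case (Suc k)
    have "cos t * cos (real n * t) = cos (real (Suc n) * t) / 2 + cos (real k * t) / 2" for t
    proof -
      have "cos (real (Suc n) * t) = cos (real n * t + t)" "cos (real k * t) = cos (real n * t - t)"
        using Suc by (simp_all add: algebra_simps)
      thus ?thesis by (simp add: cos_add cos_diff field_simps)
    qed
    hence "(\<lambda>t. c n * of_real (cos t * cos (real n * t))) = 
       (\<lambda>t. c n / 2 * of_real (cos (real (Suc n) * t)) + c n / 2 * of_real (cos (real k * t)))"
      by (simp add: algebra_simps add_divide_distrib)
    also have "\<dots> \<in> cos_polys (Suc M)"
      using that Suc by (intro lin_combs_add) (rule lin_combs_basis; simp)+
    finally show ?thesis .
  qed
  hence "(\<lambda>t. \<Sum>n<M. c n * of_real (cos t * cos (real n * t))) \<in> cos_polys (Suc M)"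
    by (intro lin_combs_sum) auto
  thus ?thesis unfolding f by (simp add: sum_distrib_left mult_ac)
qed

lemma poly_cos_in_cos_polys: "(\<lambda>t. poly p (of_real (cos t))) \<in> cos_polys (Suc (degree p))"
proof (induction p)
  case 0
  thus ?case by (simp add: lin_combs_zero)
next
  case (pCons a p)
  have const: "(\<lambda>t. a) \<in> cos_polys (Suc M)" for M
    using lin_combs_basis[of 0 "Suc M" a "\<lambda>n t. cos (real n * t)"] by simp
  show ?case
  proof (cases "p = 0")
    case False
    thus ?thesis using lin_combs_add[OF const cos_polys_mult_cos[OF pCons.IH]] by simp
  qed (use const in simp)
qed

text \<open>Weierstrass for even trigonometric polynomials, transported through \<open>x = cos t\<close>.\<close>

lemma cos_polys_dense:
  fixes \<phi> :: "real \<Rightarrow> complex"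
  assumes "continuous_on {0..pi} \<phi>" "e > 0"
  obtains M f where "f \<in> cos_polys M" "\<And>t. t \<in> {0..pi} \<Longrightarrow> norm (\<phi> t - f t) < e"
proof -
  have "continuous_on {-1..1} (\<lambda>x. \<phi> (arccos x))"
    by (rule continuous_on_compose2[OF assms(1) continuous_on_arccos']) (auto simp: arccos_lbound arccos_ubound)
  from Stone_Weierstrass_polynomial_function[OF compact_Icc this assms(2)]
  obtain g where g: "polynomial_function g" "\<forall>x\<in>{-1..1}. norm (\<phi> (arccos x) - g x) < e"
    by (elim exE conjE)
  have "real_polynomial_function (\<lambda>x. Re (g x))" "real_polynomial_function (\<lambda>x. Im (g x))"
    using g(1) bounded_linear_Re bounded_linear_Im unfolding polynomial_function_def o_def by blast+
  then obtain a n b m where ab: "(\<lambda>x. Re (g x)) = (\<lambda>x. \<Sum>i\<le>n. a i * x ^ i)" "(\<lambda>x. Im (g x)) = (\<lambda>x. \<Sum>i\<le>m. b i * x ^ i)"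
    unfolding real_polynomial_function_iff_sum by blast
  define p where "p = (\<Sum>i\<le>n. monom (complex_of_real (a i)) i) + smult \<i> (\<Sum>i\<le>m. monom (complex_of_real (b i)) i)"
  have p: "g x = poly p (of_real x)" for x
  proof -
    have "g x = of_real (Re (g x)) + \<i> * of_real (Im (g x))" by (rule complex_eq)
    also have "\<dots> = poly p (of_real x)"
      using fun_cong[OF ab(1), of x] fun_cong[OF ab(2), of x] 
      by (simp add: p_def poly_sum poly_monom)
    finally show ?thesis .
  qed
  show ?thesis
  proof (rule that[OF poly_cos_in_cos_polys[of p]])
    fix t assume "t \<in> {0..pi}"
    thus "norm (\<phi> t - poly p (of_real (cos t))) < e"
      using bspec[OF g(2), of "cos t"] p[of "cos t"] by (simp add: arccos_cos)
  qed
qed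

definition cos_sum :: "(nat \<Rightarrow> complex) \<Rightarrow> nat \<Rightarrow> real \<Rightarrow> complex" where
  "cos_sum c M t = (\<Sum>n<M. c n * of_real (cos (real n * t)))"

definition cos_sum_deriv :: "(nat \<Rightarrow> complex) \<Rightarrow> nat \<Rightarrow> real \<Rightarrow> complex" where
  "cos_sum_deriv c M t = (\<Sum>n<M. - (of_nat n * c n) * of_real (sin (real n * t)))"

lemma cos_polys_cos_sum: "cos_polys M = {f. \<exists>c. f = cos_sum c M}"
  unfolding lin_combs_def cos_sum_def by auto

lemma continuous_on_cos_sum [continuous_intros]:
  "continuous_on S (cos_sum c M)" "continuous_on S (cos_sum_deriv c M)"
  unfolding cos_sum_def cos_sum_deriv_def by (intro continuous_intros)+

lemma cos_sum_has_vector_derivative: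
  "(cos_sum c M has_vector_derivative cos_sum_deriv c M t) (at t within S)"
proof -
  have 1: "((\<lambda>t. cos (real n * t)) has_real_derivative - (real n * sin (real n * t))) (at t within S)" for n
    by (auto intro!: derivative_eq_intros)
  have "((\<lambda>t. c n * of_real (cos (real n * t))) has_vector_derivative 
      - (of_nat n * c n) * of_real (sin (real n * t))) (at t within S)" for n
    using has_vector_derivative_mult_right[OF has_vector_derivative_of_real[OF 1[of n]], of "c n"]
    by (simp add: mult_ac)
  thus ?thesis unfolding cos_sum_def cos_sum_deriv_def 
    by (intro has_vector_derivative_sum) auto
qed

lemma is_primitive_cos_sum: "is_primitive a b (cos_sum c M) (cos_sum_deriv c M)"
  by (intro is_primitive_C1 cos_sum_has_vector_derivative continuous_intros)

lemma cos_sum_add: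
  "cos_sum (\<lambda>n. c n + d n) M t = cos_sum c M t + cos_sum d M t"
  "cos_sum_deriv (\<lambda>n. c n + d n) M t = cos_sum_deriv c M t + cos_sum_deriv d M t"
  unfolding cos_sum_def cos_sum_deriv_def sum.distrib[symmetric] by (simp_all add: algebra_simps)

lemma cos_sum_diff:
  "cos_sum (\<lambda>n. c n - d n) M t = cos_sum c M t - cos_sum d M t"
  "cos_sum_deriv (\<lambda>n. c n - d n) M t = cos_sum_deriv c M t - cos_sum_deriv d M t"
  unfolding cos_sum_def cos_sum_deriv_def sum_subtractf[symmetric] by (simp_all add: algebra_simps)

text \<open>A Wirtinger inequality. Integration by parts turns the cosine coefficients of \<open>\<phi>\<close>
  into the sine coefficients of \<open>\<psi>\<close>, divided by their frequency; a frequency outside the partial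
  sum is at least \<open>M\<close>. Density of the cosine polynomials replaces Parseval's identity.
  The second bound is Bessel's inequality for those sine coefficients.\<close>

lemma cos_approximation:
  assumes p: "is_primitive 0 pi \<phi> \<psi>" and sq: "sq_int 0 pi \<psi>" and M: "M \<ge> 1"
  obtains c where "nsq 0 pi (\<lambda>t. \<phi> t - cos_sum c M t) \<le> nsq 0 pi \<psi> / (real M)\<^sup>2"
    and "nsq 0 pi (\<lambda>t. \<psi> t - cos_sum_deriv c M t) \<le> nsq 0 pi \<psi>"
proof -
  define L where "L = (\<lambda>n::nat. if n = 0 then pi else pi / 2)"
  have L: "L n > 0" "L n \<noteq> 0" for n by (simp_all add: L_def)
  define c where "c = (\<lambda>n. integral {0..pi} (\<lambda>t. \<phi> t * of_real (cos (real n * t))) / of_real (L n))"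
  have cphi: "continuous_on {0..pi} \<phi>" by (rule is_primitive_continuous[OF p])
  have sqphi: "sq_int 0 pi \<phi>" by (rule sq_int_continuous[OF cphi])
  have sine: "integral {0..pi} (\<lambda>t. \<psi> t * of_real (sin (real n * t))) = of_real (pi / 2) * (- (of_nat n * c n))" 
     if "n > 0" for n
  proof -
    have d: "((\<lambda>t. complex_of_real (sin (real n * t))) has_vector_derivative 
        (of_real (real n * cos (real n * t)))) (at t within {0..pi})" for t
      by (rule has_vector_derivative_of_real) (auto intro!: derivative_eq_intros)
    have sn: "sin (real n * pi) = 0" by (simp add: sin_npi)
    have "integral {0..pi} (\<lambda>t. \<phi> t * of_real (real n * cos (real n * t))) = 
       - integral {0..pi} (\<lambda>t. \<psi> t * of_real (sin (real n * t)))"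
      using is_primitive_by_parts[OF p pi_ge_zero d] by (simp add: sn continuous_intros)
    moreover have "integral {0..pi} (\<lambda>t. \<phi> t * of_real (real n * cos (real n * t))) =
       integral {0..pi} (\<lambda>t. of_nat n * (\<phi> t * of_real (cos (real n * t))))"
      by (rule integral_cong) simp
    ultimately show ?thesis
      using that by (simp add: c_def L_def field_simps)
  qed
  have cosexp: "nsq 0 pi (\<lambda>t. \<phi> t - cos_sum \<beta> K t) = 
     nsq 0 pi \<phi> - (\<Sum>n<K. L n * (norm (c n))\<^sup>2) + (\<Sum>n<K. L n * (norm (\<beta> n - c n))\<^sup>2)" for \<beta> K
    unfolding cos_sum_def
  proof (rule orthogonal_expansion[OF _ sqphi])
    fix n m
    show "((\<lambda>t. cos (real n * t) * cos (real m * t)) has_integral (if n = m then L n else 0)) {0..pi}"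
      unfolding L_def by (rule cos_orthogonal)
  qed (use L in \<open>auto intro!: continuous_intros simp: c_def\<close>)
  have sinexp: "nsq 0 pi (\<lambda>t. \<psi> t - cos_sum_deriv c K t) = 
     nsq 0 pi \<psi> - (\<Sum>n=1..<K. pi / 2 * (norm (of_nat n * c n))\<^sup>2)" for K
  proof -
    have "cos_sum_deriv c K t = (\<Sum>n=1..<K. - (of_nat n * c n) * of_real (sin (real n * t)))" for t
      unfolding cos_sum_deriv_def
      by (rule sum.mono_neutral_right) (auto simp: not_le)
    moreover have "nsq 0 pi (\<lambda>t. \<psi> t - (\<Sum>n=1..<K. - (of_nat n * c n) * of_real (sin (real n * t)))) =
       nsq 0 pi \<psi> - (\<Sum>n=1..<K. pi / 2 * (norm (- (of_nat n * c n)))\<^sup>2) 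
        + (\<Sum>n=1..<K. pi / 2 * (norm (- (of_nat n * c n) - - (of_nat n * c n)))\<^sup>2)"
    proof (rule orthogonal_expansion[OF _ sq])
      fix n m assume "n \<in> {1..<K}" "m \<in> {1..<K}"
      thus "((\<lambda>t. sin (real n * t) * sin (real m * t)) has_integral (if n = m then pi / 2 else 0)) {0..pi}"
        by (intro sin_orthogonal) auto
    qed (use sine in \<open>auto intro!: continuous_intros\<close>)
    ultimately show ?thesis by simp
  qed
  have "nsq 0 pi (\<lambda>t. \<phi> t - cos_sum c M t) \<le> nsq 0 pi \<psi> / (real M)\<^sup>2"
  proof (rule field_le_epsilon)
    fix \<epsilon> :: real assume eps: "\<epsilon> > 0"
    (* chosen so that a uniform error e has squared L2 norm \<epsilon> over [0, pi] *)
    define e where "e = sqrt (\<epsilon> / pi)"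
    have e: "e > 0" "pi * e\<^sup>2 = \<epsilon>" using eps by (auto simp: e_def)
    obtain K0 f where f: "f \<in> cos_polys K0" "\<And>t. t \<in> {0..pi} \<Longrightarrow> norm (\<phi> t - f t) < e"
      using cos_polys_dense[OF cphi e(1)] by blast
    define K where "K = max K0 M"
    obtain d where d: "f = cos_sum d K"
      using lin_combs_mono[OF f(1), of K] unfolding cos_polys_cos_sum K_def by auto
    have "nsq 0 pi (\<lambda>t. \<phi> t - cos_sum d K t) \<le> integral {0..pi} (\<lambda>t. e\<^sup>2)"
      unfolding nsq_def using f(2) e
      by (intro integral_le integrable_continuous_real continuous_intros cphi power_mono)
         (auto simp: d intro: less_imp_le)
    hence "nsq 0 pi \<phi> - (\<Sum>n<K. L n * (norm (c n))\<^sup>2) + (\<Sum>n<K. L n * (norm (d n - c n))\<^sup>2) \<le> \<epsilon>"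
      unfolding cosexp using e by simp
    moreover have "(\<Sum>n<K. L n * (norm (d n - c n))\<^sup>2) \<ge> 0"
      using L by (intro sum_nonneg) (simp add: less_imp_le)
    moreover have "(\<Sum>n<K. L n * (norm (c n))\<^sup>2) = (\<Sum>n<M. L n * (norm (c n))\<^sup>2) + (\<Sum>n=M..<K. L n * (norm (c n))\<^sup>2)"
    proof -
      have "{..<K} = {..<M} \<union> {M..<K}" by (auto simp: K_def)
      thus ?thesis by (simp add: sum.union_disjoint ivl_disj_int)
    qed
    moreover have "(\<Sum>n=M..<K. L n * (norm (c n))\<^sup>2) \<le> nsq 0 pi \<psi> / (real M)\<^sup>2"
    proof -
      have "(real M)\<^sup>2 * (\<Sum>n=M..<K. L n * (norm (c n))\<^sup>2) \<le> (\<Sum>n=M..<K. pi / 2 * (norm (of_nat n * c n))\<^sup>2)"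
        unfolding sum_distrib_left
      proof (rule sum_mono)
        fix n assume n: "n \<in> {M..<K}"
        have "(real M)\<^sup>2 * (pi / 2 * (norm (c n))\<^sup>2) \<le> (real n)\<^sup>2 * (pi / 2 * (norm (c n))\<^sup>2)"
          using n by (intro mult_right_mono power_mono) auto
        thus "(real M)\<^sup>2 * (L n * (norm (c n))\<^sup>2) \<le> pi / 2 * (norm (of_nat n * c n))\<^sup>2"
          using n M by (simp add: L_def norm_mult power_mult_distrib mult_ac)
      qed
      also have "\<dots> \<le> (\<Sum>n=1..<K. pi / 2 * (norm (of_nat n * c n))\<^sup>2)"
        using M by (intro sum_mono2) auto
      also have "\<dots> \<le> nsq 0 pi \<psi>"
        using sinexp[of K] nsq_nonneg[of 0 pi "\<lambda>t. \<psi> t - cos_sum_deriv c K t"] by linarith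
      finally show ?thesis using M by (simp add: le_divide_eq mult.commute)
    qed
    ultimately show "nsq 0 pi (\<lambda>t. \<phi> t - cos_sum c M t) \<le> nsq 0 pi \<psi> / (real M)\<^sup>2 + \<epsilon>"
      unfolding cosexp by simp
  qed
  moreover have "nsq 0 pi (\<lambda>t. \<psi> t - cos_sum_deriv c M t) \<le> nsq 0 pi \<psi>"
    unfolding sinexp using sum_nonneg[of "{1..<M}" "\<lambda>n. pi / 2 * (norm (of_nat n * c n))\<^sup>2"] by simp
  ultimately show ?thesis by (rule that)
qed

section \<open>Approximation along a chain of derivatives\<close>

text \<open>In the variable \<open>x = cos t\<close>, a polynomial has a polynomial primitive of one degree more.\<close>

lemma cos_sum_antiderivative:
  obtains p where "\<And>t. cos_sum_deriv p (Suc M) t = - of_real (sin t) * cos_sum c M t"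
proof -
  define e where "e = (\<lambda>n t. real n * sin (real n * t))"
  have "(\<lambda>t. c n * of_real (sin t * cos (real n * t))) \<in> lin_combs e (Suc M)" if "n < M" for n
  proof (cases n)
    case 0
    thus ?thesis using lin_combs_basis[of 1 "Suc M" "c n" e] that by (simp add: e_def)
  next
    case (Suc k)
    have "sin t * cos (real n * t) = e (Suc n) t / (2 * real (Suc n)) - e k t / (2 * real k)" for t
    proof -
      have "sin (real (Suc n) * t) = sin (real n * t + t)" "sin (real k * t) = sin (real n * t - t)"
        using Suc by (simp_all add: algebra_simps)
      hence "sin t * cos (real n * t) = sin (real (Suc n) * t) / 2 - sin (real k * t) / 2" 
        by (simp add: sin_add sin_diff field_simps)
      moreover have "e (Suc n) t / (2 * real (Suc n)) = sin (real (Suc n) * t) / 2"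
        by (simp add: e_def del: of_nat_Suc)
      moreover have "e k t / (2 * real k) = sin (real k * t) / 2"
        by (cases "k = 0") (simp_all add: e_def)
      ultimately show ?thesis by (simp only:)
    qed
    hence "(\<lambda>t. c n * of_real (sin t * cos (real n * t))) = 
       (\<lambda>t. c n / (2 * of_nat (Suc n)) * of_real (e (Suc n) t) + (- c n / (2 * of_nat k)) * of_real (e k t))"
      by (intro ext) (simp only: of_real_diff of_real_divide, simp add: algebra_simps del: of_nat_Suc)
    also have "\<dots> \<in> lin_combs e (Suc M)"
      using that Suc by (intro lin_combs_add) (rule lin_combs_basis; simp)+
    finally show ?thesis .
  qed
  hence "(\<lambda>t. \<Sum>n<M. c n * of_real (sin t * cos (real n * t))) \<in> lin_combs e (Suc M)"
    by (intro lin_combs_sum) auto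
  then obtain p where p: "(\<lambda>t. \<Sum>n<M. c n * of_real (sin t * cos (real n * t))) = 
      (\<lambda>t. \<Sum>n<Suc M. p n * of_real (e n t))"
    by (rule lin_combsE)
  show ?thesis
  proof (rule that)
    fix t
    have "cos_sum_deriv p (Suc M) t = - (\<Sum>n<Suc M. p n * of_real (e n t))"
      by (simp add: cos_sum_deriv_def e_def sum_negf[symmetric] mult_ac)
    also have "\<dots> = - of_real (sin t) * cos_sum c M t"
      unfolding fun_cong[OF p, symmetric] cos_sum_def by (simp add: sum_distrib_left sum_negf mult_ac)
    finally show "cos_sum_deriv p (Suc M) t = - of_real (sin t) * cos_sum c M t" .
  qed
qed

text \<open>What \<open>is_deriv\<close> on \<open>[-1, 1]\<close> becomes under \<open>x = cos t\<close>: the functions are composed with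
  \<open>cos\<close>, and each derivative is still taken with respect to \<open>x\<close>.\<close>

fun cos_chain :: "nat \<Rightarrow> (real \<Rightarrow> complex) \<Rightarrow> (real \<Rightarrow> complex) \<Rightarrow> bool" where
  "cos_chain 0 \<phi> g \<longleftrightarrow> (\<forall>t\<in>{0..pi}. \<phi> t = g t)"
| "cos_chain (Suc m) \<phi> g \<longleftrightarrow>
     (\<exists>\<phi>'. is_primitive 0 pi \<phi> (\<lambda>t. - of_real (sin t) * \<phi>' t) \<and> cos_chain m \<phi>' g)"

lemma sq_int_cong:
  assumes "sq_int a b g" "\<And>t. t \<in> {a..b} \<Longrightarrow> \<phi> t = g t"
  shows "sq_int a b \<phi>"
proof -
  have "\<phi> \<in> borel_measurable (lebesgue_on {a..b})"
    using assms by (subst measurable_cong[where g = g]) (auto simp: sq_int_def)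
  moreover have "(\<lambda>t. (norm (\<phi> t))\<^sup>2) integrable_on {a..b}"
    using assms by (subst integrable_cong[where g = "\<lambda>t. (norm (g t))\<^sup>2"]) (auto simp: sq_int_def)
  ultimately show ?thesis by (simp add: sq_int_def)
qed

text \<open>Approximate the derivative first, by a sum of one frequency less, subtract a primitive of that
  sum, and apply the Wirtinger inequality to the remainder; multiplication by \<open>sin t\<close> only helps.
  Lowering the number of frequencies at each step gives the quotient of factorials. The bound for
  the derivative in \<open>t\<close>, weaker by the factor \<open>M\<close>, is what a second integration by parts consumes.\<close>

lemma cos_chain_approximation:
  assumes "cos_chain s \<phi> g" "sq_int 0 pi g" "s \<le> M"
  shows "sq_int 0 pi \<phi> \<and> (\<exists>c. nsq 0 pi (\<lambda>t. \<phi> t - cos_sum c M t) \<le> (fact (M - s) / fact M)\<^sup>2 * nsq 0 pi g \<and>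
     (s > 0 \<longrightarrow> (\<exists>\<psi>. is_primitive 0 pi \<phi> \<psi> \<and> sq_int 0 pi \<psi> \<and> 
         nsq 0 pi (\<lambda>t. \<psi> t - cos_sum_deriv c M t) \<le> (real M * (fact (M - s) / fact M))\<^sup>2 * nsq 0 pi g)))"
  using assms
proof (induction s arbitrary: \<phi> M)
  case 0
  have "nsq 0 pi (\<lambda>t. \<phi> t - cos_sum (\<lambda>_. 0) M t) = nsq 0 pi g"
    using 0 unfolding nsq_def by (intro integral_cong) (simp add: cos_sum_def)
  thus ?case using sq_int_cong[OF 0(2)] 0 by (auto intro!: exI[of _ "\<lambda>_. 0"])
next
  case (Suc s)
  then obtain \<phi>' where prim: "is_primitive 0 pi \<phi> (\<lambda>t. - of_real (sin t) * \<phi>' t)" and ch: "cos_chain s \<phi>' g"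
    by auto
  obtain K where K: "M = Suc K" "s \<le> K" using Suc.prems(3) by (cases M) auto
  define \<delta> :: real where "\<delta> = fact (K - s) / fact K"
  obtain c where sq': "sq_int 0 pi \<phi>'" and c: "nsq 0 pi (\<lambda>t. \<phi>' t - cos_sum c K t) \<le> \<delta>\<^sup>2 * nsq 0 pi g"
    using Suc.IH[OF ch Suc.prems(2) K(2)] unfolding \<delta>_def by blast
  obtain p where p: "\<And>t. cos_sum_deriv p M t = - of_real (sin t) * cos_sum c K t"
    using cos_sum_antiderivative[of K c] unfolding K by blast
  have prim2: "is_primitive 0 pi (\<lambda>t. \<phi> t - cos_sum p M t) (\<lambda>t. - of_real (sin t) * (\<phi>' t - cos_sum c K t))"
    by (rule is_primitive_cong[OF is_primitive_diff[OF prim is_primitive_cos_sum[of _ _ p M]]])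
       (simp_all add: p algebra_simps)
  have sq_diff: "sq_int 0 pi (\<lambda>t. \<phi>' t - cos_sum c K t)"
    by (intro sq_int_diff sq' sq_int_continuous continuous_intros)
  have csin: "continuous_on {0..pi} (\<lambda>t. - complex_of_real (sin t))"
    by (intro continuous_intros)
  have nsin: "norm (- complex_of_real (sin t)) \<le> 1" for t by simp
  note sq2 = sq_int_mult_bounded[OF sq_diff csin nsin]
  have le: "nsq 0 pi (\<lambda>t. - of_real (sin t) * (\<phi>' t - cos_sum c K t)) \<le> \<delta>\<^sup>2 * nsq 0 pi g"
    using sq2(2) c by linarith
  obtain d where d: "nsq 0 pi (\<lambda>t. \<phi> t - cos_sum p M t - cos_sum d M t) \<le>
      nsq 0 pi (\<lambda>t. - of_real (sin t) * (\<phi>' t - cos_sum c K t)) / (real M)\<^sup>2"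
     "nsq 0 pi (\<lambda>t. - of_real (sin t) * (\<phi>' t - cos_sum c K t) - cos_sum_deriv d M t) \<le>
      nsq 0 pi (\<lambda>t. - of_real (sin t) * (\<phi>' t - cos_sum c K t))"
    using cos_approximation[OF prim2 sq2(1), of M] K by auto
  have fac: "real M * (fact (M - Suc s) / fact M) = \<delta>"
    using K by (simp add: \<delta>_def fact_Suc del: of_nat_Suc)
  show ?case
  proof (intro conjI exI impI)
    show "sq_int 0 pi \<phi>" by (intro sq_int_continuous is_primitive_continuous[OF prim])
    have "nsq 0 pi (\<lambda>t. \<phi> t - cos_sum (\<lambda>n. p n + d n) M t) \<le> \<delta>\<^sup>2 * nsq 0 pi g / (real M)\<^sup>2"
      using order_trans[OF d(1) divide_right_mono[OF le]] by (simp add: cos_sum_add diff_diff_eq)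
    also have "\<dots> = (fact (M - Suc s) / fact M)\<^sup>2 * nsq 0 pi g"
      unfolding fac[symmetric] power_mult_distrib using K by (simp del: fact_Suc of_nat_Suc)
    finally show "nsq 0 pi (\<lambda>t. \<phi> t - cos_sum (\<lambda>n. p n + d n) M t) \<le> (fact (M - Suc s) / fact M)\<^sup>2 * nsq 0 pi g" .
    show "is_primitive 0 pi \<phi> (\<lambda>t. - of_real (sin t) * \<phi>' t)" by (rule prim)
    show "sq_int 0 pi (\<lambda>t. - of_real (sin t) * \<phi>' t)"
      by (rule sq_int_mult_bounded(1)[OF sq' csin nsin])
    have "nsq 0 pi (\<lambda>t. - of_real (sin t) * \<phi>' t - cos_sum_deriv (\<lambda>n. p n + d n) M t) \<le> \<delta>\<^sup>2 * nsq 0 pi g"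
      using order_trans[OF d(2) le] by (simp add: cos_sum_add p algebra_simps)
    thus "nsq 0 pi (\<lambda>t. - of_real (sin t) * \<phi>' t - cos_sum_deriv (\<lambda>n. p n + d n) M t) 
        \<le> (real M * (fact (M - Suc s) / fact M))\<^sup>2 * nsq 0 pi g"
      unfolding fac .
  qed
qed

section \<open>Stability of interpolation at equispaced angles\<close>

lemma integral_uniform_partition:
  fixes h :: "real \<Rightarrow> real"
  assumes "h integrable_on {0..pi}" "N \<ge> 1"
  shows "(\<Sum>j<N. integral {real j * pi / real N..real (Suc j) * pi / real N} h) = integral {0..pi} h"
proof -
  have "(\<Sum>j<k. integral {real j * pi / real N..real (Suc j) * pi / real N} h) = 
      integral {0..real k * pi / real N} h" if "k \<le> N" for k
    using that
  proof (induction k)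
    case (Suc k)
    have le: "real (Suc k) * pi / real N \<le> pi"
      using Suc.prems by (simp add: divide_le_eq)
    have "integral {0..real k * pi / real N} h + integral {real k * pi / real N..real (Suc k) * pi / real N} h =
       integral {0..real (Suc k) * pi / real N} h"
      by (intro Henstock_Kurzweil_Integration.integral_combine integrable_on_subinterval[OF assms(1)])
         (use le in \<open>auto intro!: divide_right_mono mult_right_mono\<close>)
    thus ?case using Suc by simp
  qed auto
  from this[of N] show ?thesis using assms(2) by simp
qed

lemma node_bounds:
  assumes "j < N"
  shows "0 \<le> real j * pi / real N" "real j * pi / real N \<le> real (Suc j) * pi / real N" 
    "real (Suc j) * pi / real N \<le> pi" "real (Suc j) * pi / real N - real j * pi / real N = pi / real N"
proof -
  have "real (Suc j) \<le> real N" using assms by linarith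
  thus "real (Suc j) * pi / real N \<le> pi" using assms by (simp add: divide_le_eq del: of_nat_Suc)
qed (auto intro!: divide_right_mono mult_right_mono 
       simp: diff_divide_distrib[symmetric] left_diff_distrib[symmetric])

text \<open>Between consecutive zeros a function is bounded by the local variation.\<close>

lemma integral_norm_le_of_zeros:
  assumes p: "is_primitive 0 pi \<phi> \<psi>" and N: "N \<ge> 1" 
    and z: "\<And>j. j \<le> N \<Longrightarrow> \<phi> (real j * pi / real N) = 0"
  shows "integral {0..pi} (\<lambda>t. norm (\<phi> t)) \<le> pi / real N * integral {0..pi} (\<lambda>t. norm (\<psi> t))"
proof -
  have c: "continuous_on {0..pi} (\<lambda>t. norm (\<phi> t))"
    by (intro continuous_intros is_primitive_continuous[OF p])
  have ipsi: "(\<lambda>t. norm (\<psi> t)) integrable_on {0..pi}"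
    by (rule is_primitive_integrable_sub(3)[OF p]) auto
  have "integral {real j * pi / real N..real (Suc j) * pi / real N} (\<lambda>t. norm (\<phi> t)) \<le>
        pi / real N * integral {real j * pi / real N..real (Suc j) * pi / real N} (\<lambda>t. norm (\<psi> t))"
     if j: "j < N" for j
  proof -
    note b = node_bounds[OF j]
    let ?x = "real j * pi / real N" and ?y = "real (Suc j) * pi / real N"
    have "integral {?x..?y} (\<lambda>t. norm (\<phi> t)) \<le> integral {?x..?y} (\<lambda>_. integral {?x..?y} (\<lambda>t. norm (\<psi> t)))"
    proof (rule integral_le)
      show "(\<lambda>t. norm (\<phi> t)) integrable_on {?x..?y}"
        using b by (intro integrable_continuous_real continuous_on_subset[OF c]) auto
      fix t assume t: "t \<in> {?x..?y}"
      have "norm (\<phi> t - \<phi> ?x) \<le> integral {?x..t} (\<lambda>t. norm (\<psi> t))"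
        using t b by (intro is_primitive_increment(2)[OF p]) auto
      also have "\<dots> \<le> integral {?x..?y} (\<lambda>t. norm (\<psi> t))"
        using t b by (intro integral_subset_le is_primitive_integrable_sub(3)[OF p]) auto
      finally show "norm (\<phi> t) \<le> integral {?x..?y} (\<lambda>t. norm (\<psi> t))"
        using z[of j] j by simp
    qed auto
    also have "\<dots> = pi / real N * integral {?x..?y} (\<lambda>t. norm (\<psi> t))"
      using b(2) unfolding b(4)[symmetric] by (simp del: of_nat_Suc)
    finally show ?thesis .
  qed
  hence "(\<Sum>j<N. integral {real j * pi / real N..real (Suc j) * pi / real N} (\<lambda>t. norm (\<phi> t))) \<le>
     (\<Sum>j<N. pi / real N * integral {real j * pi / real N..real (Suc j) * pi / real N} (\<lambda>t. norm (\<psi> t)))"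
    by (intro sum_mono) auto
  thus ?thesis
    unfolding sum_distrib_left[symmetric] integral_uniform_partition[OF ipsi N]
      integral_uniform_partition[OF integrable_continuous_real[OF c] N] .
qed

text \<open>Multiplication by twice the sine of half the step makes the sum telescope, and both ends
  are sines of multiples of \<open>\<pi>\<close>.\<close>

lemma cos_midpoint_sum:
  assumes "l \<noteq> 0" "\<bar>l\<bar> < 2 * int N"
  shows "(\<Sum>j<N. cos (of_int l * ((real j + 1 / 2) * pi / real N))) = 0"
proof -
  let ?h = "of_int l * pi / (2 * real N) :: real"
  have N: "N > 0" using assms by auto
  have "sin ?h \<noteq> 0"
  proof
    assume "sin ?h = 0"
    then obtain i :: int where "?h = of_int i * pi" unfolding sin_zero_iff_int2 by blast
    hence "real_of_int l = real_of_int (i * (2 * int N))" using N by (simp add: field_simps)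
    hence l: "l = i * (2 * int N)" by (simp only: of_int_eq_iff)
    hence "\<bar>l\<bar> = \<bar>i\<bar> * (2 * int N)" by (simp add: abs_mult)
    moreover have "\<bar>i\<bar> \<ge> 1" using assms(1) l by auto
    ultimately show False using assms(2) mult_right_mono[of 1 "\<bar>i\<bar>" "2 * int N"] by linarith
  qed
  moreover have "2 * sin ?h * (\<Sum>j<N. cos (of_int l * ((real j + 1 / 2) * pi / real N))) = 
      (\<Sum>j<N. sin (of_int l * (real (Suc j) * pi / real N)) - sin (of_int l * (real j * pi / real N)))"
    unfolding sum_distrib_left
  proof (rule sum.cong[OF refl])
    fix j
    have "of_int l * (real (Suc j) * pi / real N) = of_int l * ((real j + 1 / 2) * pi / real N) + ?h"
         "of_int l * (real j * pi / real N) = of_int l * ((real j + 1 / 2) * pi / real N) - ?h"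
      using N by (simp_all add: field_simps)
    thus "2 * sin ?h * cos (of_int l * ((real j + 1 / 2) * pi / real N)) = 
       sin (of_int l * (real (Suc j) * pi / real N)) - sin (of_int l * (real j * pi / real N))"
      by (simp only: sin_add sin_diff) simp
  qed
  moreover have "(\<Sum>j<N. sin (of_int l * (real (Suc j) * pi / real N)) - sin (of_int l * (real j * pi / real N))) = 0"
  proof -
    have "sin (of_int l * pi) = 0" by (simp add: sin_zero_iff_int2)
    thus ?thesis
      using sum_lessThan_telescope[of "\<lambda>j. sin (of_int l * (real j * pi / real N))" N] N by simp
  qed
  ultimately show ?thesis by simp
qed

lemma sin_midpoint_orthogonal:
  assumes "n \<in> {1..N}" "m \<in> {1..N}"
  shows "(\<Sum>j<N. sin (real n * ((real j + 1 / 2) * pi / real N)) * sin (real m * ((real j + 1 / 2) * pi / real N))) =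
           (if n = m then (if n = N then real N else real N / 2) else 0)"
proof -
  let ?x = "\<lambda>j. (real j + 1 / 2) * pi / real N"
  have prod: "sin (real n * x) * sin (real m * x) = 
     (cos (of_int (int n - int m) * x) - cos (of_int (int n + int m) * x)) / 2" for x
    by (simp add: cos_add cos_diff ring_distribs)
  have eq: "(\<Sum>j<N. sin (real n * ?x j) * sin (real m * ?x j)) = 
     ((\<Sum>j<N. cos (of_int (int n - int m) * ?x j)) - (\<Sum>j<N. cos (of_int (int n + int m) * ?x j))) / 2"
    unfolding sum_subtractf[symmetric] sum_divide_distrib prod ..
  have last: "(\<Sum>j<N. cos (of_int (int N + int N) * ?x j)) = - real N"
  proof -
    have "cos (of_int (int N + int N) * ?x j) = -1" for j
    proof -
      have "of_int (int N + int N) * ?x j = real (2 * j + 1) * pi"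
        using assms by (simp add: field_simps)
      thus ?thesis by (simp only: cos_npi) simp
    qed
    thus ?thesis by (simp only: sum_constant) simp
  qed
  show ?thesis
  proof (cases "n = m")
    case True
    show ?thesis
    proof (cases "n = N")
      case True
      thus ?thesis using \<open>n = m\<close> last unfolding eq by simp
    next
      case False
      hence "(\<Sum>j<N. cos (of_int (int n + int m) * ?x j)) = 0"
        using assms True by (intro cos_midpoint_sum) auto
      thus ?thesis using True False unfolding eq by simp
    qed
  next
    case False
    hence "(\<Sum>j<N. cos (of_int (int n + int m) * ?x j)) = 0" "(\<Sum>j<N. cos (of_int (int n - int m) * ?x j)) = 0"
      using assms by (intro cos_midpoint_sum; force)+
    thus ?thesis using False unfolding eq by simp
  qed
qed

text \<open>Parseval's identity for a family that is orthogonal for summation over \<open>J\<close>.\<close>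

lemma discrete_orthogonal_expansion:
  fixes e :: "'i \<Rightarrow> 'j \<Rightarrow> real" and \<beta> :: "'i \<Rightarrow> complex"
  assumes "finite A" and orth: "\<And>n m. n \<in> A \<Longrightarrow> m \<in> A \<Longrightarrow> (\<Sum>j\<in>J. e n j * e m j) = (if n = m then \<Lambda> n else 0)"
  shows "(\<Sum>j\<in>J. (norm (\<Sum>n\<in>A. \<beta> n * of_real (e n j)))\<^sup>2) = (\<Sum>n\<in>A. \<Lambda> n * (norm (\<beta> n))\<^sup>2)"
proof -
  have "complex_of_real (\<Sum>j\<in>J. (norm (\<Sum>n\<in>A. \<beta> n * of_real (e n j)))\<^sup>2) = 
      (\<Sum>j\<in>J. \<Sum>n\<in>A. \<Sum>m\<in>A. \<beta> n * cnj (\<beta> m) * of_real (e n j * e m j))"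
    by (simp add: complex_norm_square sum_product mult_ac del: of_real_power)
  also have "\<dots> = (\<Sum>n\<in>A. \<Sum>m\<in>A. \<beta> n * cnj (\<beta> m) * of_real (\<Sum>j\<in>J. e n j * e m j))"
    unfolding sum.swap[of _ _ J] of_real_sum sum_distrib_left ..
  also have "\<dots> = (\<Sum>n\<in>A. \<Sum>m\<in>A. \<beta> n * cnj (\<beta> m) * of_real (if n = m then \<Lambda> n else 0))"
    by (intro sum.cong refl) (simp add: orth)
  also have "\<dots> = of_real (\<Sum>n\<in>A. \<Lambda> n * (norm (\<beta> n))\<^sup>2)"
    using assms(1) by (simp add: complex_norm_square if_distrib if_distribR mult_ac cong: if_cong del: of_real_power)
  finally show ?thesis unfolding of_real_eq_iff .
qed

text \<open>Jordan's inequality, from concavity of the sine.\<close>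

lemma sin_ge_chord:
  fixes x :: real
  assumes "0 \<le> x" "x \<le> pi / 2"
  shows "sin x \<ge> 2 * x / pi"
proof -
  have "convex_on {0..pi/2} (\<lambda>x. - sin x)"
  proof (rule f''_ge0_imp_convex)
    show "((\<lambda>x. - sin x) has_real_derivative - cos x) (at x)" for x :: real
      by (auto intro!: derivative_eq_intros)
    show "((\<lambda>x. - cos x) has_real_derivative sin x) (at x)" for x :: real
      by (auto intro!: derivative_eq_intros)
    show "0 \<le> sin x" if "x \<in> {0..pi / 2}" for x :: real
      using that by (intro sin_ge_zero) auto
  qed auto
  from convex_onD[OF this, of "2 * x / pi" 0 "pi / 2"] show ?thesis
    using assms by (simp add: field_simps)
qed

text \<open>Stability of cosine interpolation in the first-order seminorm. The increments of the
  interpolant between nodes are those of \<open>\<phi>\<close>, and they are a sine sum at the midpoints, where sines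
  are orthogonal for summation.\<close>

lemma interpolation_stability:
  assumes p: "is_primitive 0 pi \<phi> \<psi>" and sq: "sq_int 0 pi \<psi>" and N: "N \<ge> 1"
    and nodes: "\<And>j. j \<le> N \<Longrightarrow> cos_sum b (Suc N) (real j * pi / real N) = \<phi> (real j * pi / real N)"
  shows "(\<Sum>n\<le>N. (real n * norm (b n))\<^sup>2) \<le> pi / 2 * nsq 0 pi \<psi>"
proof -
  let ?\<theta> = "\<lambda>j. real j * pi / real N" and ?x = "\<lambda>j. (real j + 1 / 2) * pi / real N"
  let ?s = "\<lambda>n. sin (real n * pi / (2 * real N))"
  define \<Delta> where "\<Delta> = (\<lambda>j. cos_sum b (Suc N) (?\<theta> (Suc j)) - cos_sum b (Suc N) (?\<theta> j))"
  have \<Delta>: "\<Delta> j = (\<Sum>n\<in>{1..N}. (- 2 * of_real (?s n) * b n) * of_real (sin (real n * ?x j)))" for j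
  proof -
    have "\<Delta> j = (\<Sum>n<Suc N. (- 2 * of_real (?s n) * b n) * of_real (sin (real n * ?x j)))"
      unfolding \<Delta>_def cos_sum_def sum_subtractf[symmetric]
    proof (rule sum.cong[OF refl])
      fix n
      have "real n * ?\<theta> (Suc j) = real n * ?x j + real n * pi / (2 * real N)" 
         "real n * ?\<theta> j = real n * ?x j - real n * pi / (2 * real N)"
        using N by (simp_all add: field_simps)
      hence "cos (real n * ?\<theta> (Suc j)) - cos (real n * ?\<theta> j) = - 2 * ?s n * sin (real n * ?x j)"
        by (simp only: cos_add cos_diff) simp
      hence "b n * of_real (cos (real n * ?\<theta> (Suc j)) - cos (real n * ?\<theta> j)) = 
           b n * of_real (- 2 * ?s n * sin (real n * ?x j))" by (simp only:)
      thus "b n * of_real (cos (real n * ?\<theta> (Suc j))) - b n * of_real (cos (real n * ?\<theta> j)) =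
         (- 2 * of_real (?s n) * b n) * of_real (sin (real n * ?x j))"
        by (simp add: algebra_simps)
    qed
    also have "\<dots> = (\<Sum>n\<in>{1..N}. (- 2 * of_real (?s n) * b n) * of_real (sin (real n * ?x j)))"
      by (rule sum.mono_neutral_right) (auto simp: not_le)
    finally show ?thesis .
  qed
  have "(\<Sum>j<N. (norm (\<Delta> j))\<^sup>2) = 
     (\<Sum>n\<in>{1..N}. (if n = N then real N else real N / 2) * (norm (- 2 * of_real (?s n) * b n))\<^sup>2)"
    unfolding \<Delta> by (rule discrete_orthogonal_expansion) (simp, rule sin_midpoint_orthogonal)
  also have "\<dots> \<ge> (\<Sum>n\<in>{1..N}. 2 / real N * (real n * norm (b n))\<^sup>2)"
  proof (rule sum_mono)
    fix n assume n: "n \<in> {1..N}"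
    have s: "real n / real N \<le> ?s n"
      using sin_ge_chord[of "real n * pi / (2 * real N)"] n N by (simp add: field_simps)
    have s0: "0 \<le> ?s n" using order_trans[OF _ s, of 0] by simp
    have "2 / real N * (real n * norm (b n))\<^sup>2 = real N / 2 * (2 * (real n / real N) * norm (b n))\<^sup>2"
      using N by (simp add: power2_eq_square field_simps)
    also have "\<dots> \<le> (if n = N then real N else real N / 2) * (2 * ?s n * norm (b n))\<^sup>2"
      using s s0 N by (intro mult_mono power_mono) auto
    also have "2 * ?s n * norm (b n) = norm (- 2 * of_real (?s n) * b n)"
      using s0 by (simp add: norm_mult)
    finally show "2 / real N * (real n * norm (b n))\<^sup>2 \<le> 
       (if n = N then real N else real N / 2) * (norm (- 2 * of_real (?s n) * b n))\<^sup>2" .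
  qed
  finally have lower: "2 / real N * (\<Sum>n\<in>{1..N}. (real n * norm (b n))\<^sup>2) \<le> (\<Sum>j<N. (norm (\<Delta> j))\<^sup>2)"
    by (simp add: sum_distrib_left)
  have "(norm (\<Delta> j))\<^sup>2 \<le> pi / real N * nsq (?\<theta> j) (?\<theta> (Suc j)) \<psi>" if j: "j < N" for j
  proof -
    note b = node_bounds[OF j]
    have "norm (\<Delta> j) \<le> integral {?\<theta> j..?\<theta> (Suc j)} (\<lambda>t. norm (\<psi> t))"
      unfolding \<Delta>_def using is_primitive_increment(2)[OF p b(1,2,3)] nodes[of j] nodes[of "Suc j"] j by simp
    hence "(norm (\<Delta> j))\<^sup>2 \<le> (integral {?\<theta> j..?\<theta> (Suc j)} (\<lambda>t. norm (\<psi> t)))\<^sup>2"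
      by (intro power_mono) auto
    also have "\<dots> \<le> (?\<theta> (Suc j) - ?\<theta> j) * nsq (?\<theta> j) (?\<theta> (Suc j)) \<psi>"
      using b by (intro integral_norm_sq_le sq_int_subinterval[OF sq])
    finally show ?thesis unfolding b(4) .
  qed
  hence "(\<Sum>j<N. (norm (\<Delta> j))\<^sup>2) \<le> (\<Sum>j<N. pi / real N * nsq (?\<theta> j) (?\<theta> (Suc j)) \<psi>)"
    by (intro sum_mono) auto
  also have "\<dots> = pi / real N * nsq 0 pi \<psi>"
    unfolding nsq_def sum_distrib_left[symmetric]
    using sq by (subst integral_uniform_partition[OF _ N]) (auto simp: sq_int_def)
  finally have "2 / real N * (\<Sum>n\<in>{1..N}. (real n * norm (b n))\<^sup>2) \<le> pi / real N * nsq 0 pi \<psi>"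
    using lower by linarith
  moreover have "(\<Sum>n\<le>N. (real n * norm (b n))\<^sup>2) = (\<Sum>n\<in>{1..N}. (real n * norm (b n))\<^sup>2)"
    by (rule sum.mono_neutral_right) (auto simp: not_le)
  ultimately show ?thesis using N by (simp add: field_simps)
qed

section \<open>Oscillatory integrals of the interpolation error\<close>

lemma sin_multiple:
  "sin (real n * t) = sin t * (\<Sum>i<n. cos ((real n - 1 - 2 * real i) * t))"
proof -
  have "2 * (sin t * (\<Sum>i<n. cos ((real n - 1 - 2 * real i) * t))) =
      (\<Sum>i<n. sin ((real n - 2 * real i) * t) - sin ((real n - 2 * real (Suc i)) * t))"
    unfolding sum_distrib_left
  proof (rule sum.cong[OF refl])
    fix i
    have "(real n - 2 * real i) * t = (real n - 1 - 2 * real i) * t + t"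
      "(real n - 2 * real (Suc i)) * t = (real n - 1 - 2 * real i) * t - t"
      by (simp_all add: algebra_simps)
    thus "2 * (sin t * cos ((real n - 1 - 2 * real i) * t)) =
       sin ((real n - 2 * real i) * t) - sin ((real n - 2 * real (Suc i)) * t)"
      by (simp only: sin_add sin_diff) simp
  qed
  also have "\<dots> = sin (real n * t) - sin (- (real n * t))"
    using sum_lessThan_telescope'[of "\<lambda>i. sin ((real n - 2 * real i) * t)" n] by simp
  finally show ?thesis by simp
qed

text \<open>The derivative of an algebraic polynomial, read off from its cosine form: the quotient of
  \<open>sin (n t)\<close> by \<open>sin t\<close> is a sum of \<open>n\<close> cosines of frequencies below \<open>n\<close>, so it costs a factor
  \<open>n\<close> and its derivative a factor \<open>n\<^sup>2\<close>.\<close>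

lemma cos_sum_slope:
  obtains q q' where "is_primitive 0 pi q q'" "continuous_on {0..pi} q'"
    "\<And>t. cos_sum_deriv b (Suc N) t = - of_real (sin t) * q t"
    "\<And>t. norm (q t) \<le> sqrt (real N ^ 5 * (\<Sum>n\<le>N. (real n * norm (b n))\<^sup>2))"
    "\<And>t. norm (q' t) \<le> sqrt (real N ^ 5 * (\<Sum>n\<le>N. (real n * norm (b n))\<^sup>2))"
proof -
  define \<nu> where "\<nu> = (\<lambda>n i. real n - 1 - 2 * real i)"
  define q where "q = (\<lambda>t. \<Sum>n\<le>N. of_nat n * b n * (\<Sum>i<n. of_real (cos (\<nu> n i * t))))"
  define q' where "q' = (\<lambda>t. \<Sum>n\<le>N. of_nat n * b n * (\<Sum>i<n. of_real (- (\<nu> n i * sin (\<nu> n i * t)))))"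
  have \<nu>: "\<bar>\<nu> n i\<bar> \<le> real n" if "i < n" for n i
    using that by (simp add: \<nu>_def abs_le_iff)
  define T where "T = (\<Sum>n\<le>N. (real n)\<^sup>2 * (real n * norm (b n)))"
  have "T\<^sup>2 \<le> (\<Sum>n\<le>N. ((real n)\<^sup>2)\<^sup>2) * (\<Sum>n\<le>N. (real n * norm (b n))\<^sup>2)"
    unfolding T_def by (rule Cauchy_Schwarz_ineq_sum)
  also have "(\<Sum>n\<le>N. ((real n)\<^sup>2)\<^sup>2) \<le> real N ^ 5"
  proof -
    have "(\<Sum>n\<le>N. ((real n)\<^sup>2)\<^sup>2) = (\<Sum>n\<in>{1..N}. ((real n)\<^sup>2)\<^sup>2)"
      by (rule sum.mono_neutral_right) (auto simp: not_le)
    also have "\<dots> \<le> (\<Sum>n\<in>{1..N}. ((real N)\<^sup>2)\<^sup>2)"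
      by (intro sum_mono power_mono) auto
    also have "\<dots> = real N ^ 5" by (simp flip: power_mult) (simp add: eval_nat_numeral)
    finally show ?thesis .
  qed
  finally have T: "T \<le> sqrt (real N ^ 5 * (\<Sum>n\<le>N. (real n * norm (b n))\<^sup>2))"
    by (intro real_le_rsqrt) (simp add: mult_right_mono sum_nonneg)
  show ?thesis
  proof (rule that)
    show cq': "continuous_on {0..pi} q'" unfolding q'_def by (intro continuous_intros)
    have d: "((\<lambda>t. complex_of_real (cos (\<nu> n i * t))) has_vector_derivative 
        of_real (- (\<nu> n i * sin (\<nu> n i * t)))) (at t within {0..pi})" for n i t
      by (rule has_vector_derivative_of_real) (auto intro!: derivative_eq_intros)
    have "(q has_vector_derivative q' t) (at t within {0..pi})" for t
      unfolding q_def q'_def 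
      by (intro has_vector_derivative_sum has_vector_derivative_mult_right d)
    thus "is_primitive 0 pi q q'" by (intro is_primitive_C1 cq')
    show "cos_sum_deriv b (Suc N) t = - of_real (sin t) * q t" for t
      unfolding cos_sum_deriv_def q_def \<nu>_def lessThan_Suc_atMost sin_multiple[of _ t]
      by (simp add: sum_distrib_left sum_negf mult_ac)
    show "norm (q t) \<le> sqrt (real N ^ 5 * (\<Sum>n\<le>N. (real n * norm (b n))\<^sup>2))" for t
    proof -
      have "norm (q t) \<le> T"
        unfolding q_def T_def
      proof (intro sum_norm_le)
        fix n
        have "norm (\<Sum>i<n. complex_of_real (cos (\<nu> n i * t))) \<le> (\<Sum>i<n. 1)"
          by (intro sum_norm_le) simp
        hence "norm (of_nat n * b n * (\<Sum>i<n. of_real (cos (\<nu> n i * t)))) \<le> real n * norm (b n) * real n"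
          by (simp add: norm_mult mult_left_mono)
        also have "\<dots> \<le> (real n)\<^sup>2 * (real n * norm (b n))"
          using mult_left_mono[of 1 "real n" "real n * norm (b n) * real n"]
          by (cases "n = 0") (simp_all add: power2_eq_square mult_ac)
        finally show "norm (of_nat n * b n * (\<Sum>i<n. of_real (cos (\<nu> n i * t)))) \<le> (real n)\<^sup>2 * (real n * norm (b n))" .
      qed
      thus ?thesis using T by linarith
    qed
    show "norm (q' t) \<le> sqrt (real N ^ 5 * (\<Sum>n\<le>N. (real n * norm (b n))\<^sup>2))" for t
    proof -
      have "norm (q' t) \<le> T"
        unfolding q'_def T_def
      proof (intro sum_norm_le)
        fix n
        have "norm (\<Sum>i<n. complex_of_real (- (\<nu> n i * sin (\<nu> n i * t)))) \<le> (\<Sum>i<n. real n)"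
        proof (intro sum_norm_le)
          fix i assume "i \<in> {..<n}"
          hence "\<bar>\<nu> n i\<bar> * \<bar>sin (\<nu> n i * t)\<bar> \<le> real n * 1" by (intro mult_mono \<nu>) auto
          thus "norm (complex_of_real (- (\<nu> n i * sin (\<nu> n i * t)))) \<le> real n"
            by (simp add: norm_mult)
        qed
        hence "norm (of_nat n * b n * (\<Sum>i<n. of_real (- (\<nu> n i * sin (\<nu> n i * t))))) \<le> real n * norm (b n) * (real n * real n)"
          unfolding norm_mult norm_of_nat sum_constant card_lessThan by (rule mult_left_mono) simp
        thus "norm (of_nat n * b n * (\<Sum>i<n. of_real (- (\<nu> n i * sin (\<nu> n i * t))))) \<le> (real n)\<^sup>2 * (real n * norm (b n))"
          by (simp add: power2_eq_square mult_ac)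
      qed
      thus ?thesis using T by linarith
    qed
  qed
qed

lemma nsq_cos_sum_deriv:
  "nsq 0 pi (cos_sum_deriv b (Suc N)) = pi / 2 * (\<Sum>n\<le>N. (real n * norm (b n))\<^sup>2)"
proof -
  have eq: "cos_sum_deriv b (Suc N) t = (\<Sum>n\<in>{1..N}. - (of_nat n * b n) * of_real (sin (real n * t)))" for t
    unfolding cos_sum_deriv_def by (rule sum.mono_neutral_right) (auto simp: not_le)
  have "nsq 0 pi (\<lambda>t. 0 - (\<Sum>n\<in>{1..N}. (of_nat n * b n) * of_real (sin (real n * t)))) =
     nsq 0 pi (\<lambda>t. 0) - (\<Sum>n\<in>{1..N}. pi / 2 * (norm (0 :: complex))\<^sup>2) + (\<Sum>n\<in>{1..N}. pi / 2 * (norm (of_nat n * b n - 0))\<^sup>2)"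
  proof (rule orthogonal_expansion)
    fix n m assume "n \<in> {1..N}" "m \<in> {1..N}"
    thus "((\<lambda>t. sin (real n * t) * sin (real m * t)) has_integral (if n = m then pi / 2 else 0)) {0..pi}"
      by (intro sin_orthogonal) auto
  qed (auto intro!: continuous_intros sq_int_continuous)
  also have "(\<lambda>t. 0 - (\<Sum>n\<in>{1..N}. (of_nat n * b n) * of_real (sin (real n * t)))) = cos_sum_deriv b (Suc N)"
    by (rule ext) (simp only: eq, simp add: sum_negf)
  also have "nsq 0 pi (\<lambda>t. 0) = 0" by (simp add: nsq_def)
  also have "(\<Sum>n\<in>{1..N}. pi / 2 * (norm (of_nat n * b n - 0))\<^sup>2) = pi / 2 * (\<Sum>n\<le>N. (real n * norm (b n))\<^sup>2)"
    unfolding sum_distrib_left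
    by (rule sum.mono_neutral_cong_left) (auto simp: not_le norm_mult)
  finally show ?thesis by simp
qed

lemma norm_le_average_plus_variation:
  assumes p: "is_primitive 0 pi \<phi> \<psi>" and x: "x \<in> {0..pi}"
  shows "pi * norm (\<phi> x) \<le> integral {0..pi} (\<lambda>t. norm (\<phi> t)) + pi * integral {0..pi} (\<lambda>t. norm (\<psi> t))"
proof -
  have c: "continuous_on {0..pi} (\<lambda>t. norm (\<phi> t))"
    by (intro continuous_intros is_primitive_continuous[OF p])
  let ?V = "integral {0..pi} (\<lambda>t. norm (\<psi> t))"
  have V: "integral {u..v} (\<lambda>t. norm (\<psi> t)) \<le> ?V" if "0 \<le> u" "u \<le> v" "v \<le> pi" for u v
    using that by (intro integral_subset_le is_primitive_integrable_sub(3)[OF p]) auto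
  have "integral {0..pi} (\<lambda>t. norm (\<phi> x)) \<le> integral {0..pi} (\<lambda>t. norm (\<phi> t) + ?V)"
  proof (rule integral_le)
    show "(\<lambda>t. norm (\<phi> t) + ?V) integrable_on {0..pi}"
      by (intro integrable_continuous_real continuous_intros c)
    fix t assume t: "t \<in> {0..pi}"
    have "norm (\<phi> x - \<phi> t) \<le> ?V"
    proof (cases "t \<le> x")
      case True
      thus ?thesis using is_primitive_increment(2)[OF p, of t x] V[of t x] t x by auto
    next
      case False
      thus ?thesis using is_primitive_increment(2)[OF p, of x t] V[of x t] t x by (auto simp: norm_minus_commute)
    qed
    thus "norm (\<phi> x) \<le> norm (\<phi> t) + ?V" using norm_triangle_ineq2[of "\<phi> x" "\<phi> t"] by linarith
  qed auto
  also have "\<dots> = integral {0..pi} (\<lambda>t. norm (\<phi> t)) + pi * ?V"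
    using integrable_continuous_real[OF c] by (subst Henstock_Kurzweil_Integration.integral_add) auto
  finally show ?thesis by simp
qed

text \<open>Up to the factor \<open>- \<i> k\<close>, the kernel \<open>sin t exp (\<i> k cos t)\<close> is the derivative of
  \<open>exp (\<i> k cos t)\<close>, so each integration by parts gains \<open>1/k\<close>.\<close>

lemma osc_by_parts_eq:
  assumes p: "is_primitive 0 pi \<phi> \<psi>" and k: "k > 0"
  shows "integral {0..pi} (\<lambda>t. \<phi> t * (of_real (sin t) * exp (\<i> * of_real (k * cos t)))) =
     \<i> / of_real k * (\<phi> pi * exp (\<i> * of_real (k * cos pi)) - \<phi> 0 * exp (\<i> * of_real (k * cos 0)) 
        - integral {0..pi} (\<lambda>t. \<psi> t * exp (\<i> * of_real (k * cos t))))"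
proof -
  define v where "v = (\<lambda>t. exp (\<i> * of_real (k * cos t)))"
  define v' where "v' = (\<lambda>t. - \<i> * of_real k * (of_real (sin t) * exp (\<i> * of_real (k * cos t))))"
  have v: "(v has_vector_derivative v' t) (at t within {0..pi})" for t
  proof -
    have "((\<lambda>t. \<i> * complex_of_real (k * cos t)) has_vector_derivative \<i> * of_real (- (k * sin t))) (at t within {0..pi})"
      by (intro has_vector_derivative_mult_right has_vector_derivative_of_real) (auto intro!: derivative_eq_intros)
    from field_vector_diff_chain_within[OF this, of exp "exp (\<i> * of_real (k * cos t))"]
    have "((exp \<circ> (\<lambda>t. \<i> * complex_of_real (k * cos t))) has_vector_derivative
      \<i> * of_real (- (k * sin t)) * exp (\<i> * of_real (k * cos t))) (at t within {0..pi})"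
      by (auto intro: DERIV_exp[THEN has_field_derivative_at_within])
    thus ?thesis by (simp add: v_def v'_def o_def mult_ac)
  qed
  have cv': "continuous_on {0..pi} v'" unfolding v'_def by (intro continuous_intros)
  define X where "X = integral {0..pi} (\<lambda>t. \<phi> t * (of_real (sin t) * exp (\<i> * of_real (k * cos t))))"
  have "integral {0..pi} (\<lambda>t. \<phi> t * v' t) = - \<i> * of_real k * X"
    unfolding v'_def X_def integral_mult_right[symmetric] by (rule integral_cong) (simp add: mult_ac)
  with is_primitive_by_parts[OF p pi_ge_zero v cv']
  have "- \<i> * of_real k * X = \<phi> pi * v pi - \<phi> 0 * v 0 - integral {0..pi} (\<lambda>t. \<psi> t * v t)"
    by simp
  note this[symmetric]
  hence "\<i> / of_real k * (\<phi> pi * v pi - \<phi> 0 * v 0 - integral {0..pi} (\<lambda>t. \<psi> t * v t)) = X"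
    using k by simp
  thus ?thesis unfolding X_def v_def ..
qed

lemma osc_by_parts:
  assumes p: "is_primitive 0 pi \<phi> \<psi>" and k: "k > 0"
  shows "norm (integral {0..pi} (\<lambda>t. \<phi> t * (of_real (sin t) * exp (\<i> * of_real (k * cos t))))) \<le>
     (norm (\<phi> 0) + norm (\<phi> pi) + integral {0..pi} (\<lambda>t. norm (\<psi> t))) / k"
proof -
  define v where "v = (\<lambda>t. exp (\<i> * of_real (k * cos t)))"
  have nv: "norm (v t) = 1" for t by (simp add: v_def)
  have cv: "continuous_on {0..pi} v" unfolding v_def by (intro continuous_intros)
  have "norm (integral {0..pi} (\<lambda>t. \<phi> t * (of_real (sin t) * exp (\<i> * of_real (k * cos t))))) =
     norm (\<phi> pi * v pi - \<phi> 0 * v 0 - integral {0..pi} (\<lambda>t. \<psi> t * v t)) / k"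
    using k by (subst osc_by_parts_eq[OF p k]) (simp add: v_def norm_mult norm_divide)
  also have "\<dots> \<le> (norm (\<phi> pi * v pi) + norm (\<phi> 0 * v 0) + norm (integral {0..pi} (\<lambda>t. \<psi> t * v t))) / k"
    using k by (intro divide_right_mono order_trans[OF norm_triangle_ineq4] add_right_mono norm_triangle_ineq4) auto
  also have "\<dots> \<le> (norm (\<phi> pi) + norm (\<phi> 0) + integral {0..pi} (\<lambda>t. norm (\<psi> t))) / k"
  proof -
    have "(\<lambda>t. \<psi> t * v t) integrable_on {0..pi}"
      using absolutely_integrable_continuous_mult[OF cv is_primitiveD(1)[OF p]]
      by (simp add: absolutely_integrable_on_def mult.commute)
    hence "norm (integral {0..pi} (\<lambda>t. \<psi> t * v t)) \<le> integral {0..pi} (\<lambda>t. norm (\<psi> t))"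
      using is_primitive_integrable_sub(3)[OF p, of 0 pi]
      by (intro integral_norm_bound_integral) (auto simp: norm_mult nv)
    thus ?thesis using k by (intro divide_right_mono) (simp_all add: norm_mult nv)
  qed
  finally show ?thesis by (simp add: add_ac)
qed

lemma sqrt_mult_sq_le:
  assumes "x \<le> r\<^sup>2 * s\<^sup>2" "0 \<le> r" "0 \<le> s"
  shows "sqrt x \<le> r * s"
  using assms by (intro real_le_lsqrt) (auto simp: power_mult_distrib)

lemma integral_norm_le_of_nsq:
  assumes "sq_int 0 pi \<phi>" "nsq 0 pi \<phi> \<le> c\<^sup>2 * D\<^sup>2" "0 \<le> c" "0 \<le> D"
  shows "integral {0..pi} (\<lambda>t. norm (\<phi> t)) \<le> 2 * c * D"
proof -
  have "integral {0..pi} (\<lambda>t. norm (\<phi> t)) \<le> sqrt ((pi - 0) * nsq 0 pi \<phi>)"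
    by (rule integral_norm_le_sqrt[OF assms(1) pi_ge_zero])
  also have "\<dots> \<le> (2 * c) * D"
  proof (rule sqrt_mult_sq_le)
    have "pi * nsq 0 pi \<phi> \<le> 4 * (c\<^sup>2 * D\<^sup>2)"
      using assms pi_less_4 nsq_nonneg[of 0 pi \<phi>] by (intro mult_mono) auto
    thus "(pi - 0) * nsq 0 pi \<phi> \<le> (2 * c)\<^sup>2 * D\<^sup>2" by (simp add: power_mult_distrib)
  qed (use assms in auto)
  finally show ?thesis .
qed

text \<open>Interpolation reproduces the polynomial \<open>P\<close> whose derivative with respect to \<open>x = cos t\<close> is
  the approximation, with frequencies below \<open>N\<close>, to that of \<open>\<phi>\<close>; so \<open>P\<close> may be subtracted.
  Stability then bounds the interpolant of the remainder in the first-order seminorm alone, so that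
  no aliased Fourier coefficient has to be estimated. The square root of \<open>N ^ 5\<close> is the price of a
  second derivative of that interpolant, by \<open>cos_sum_slope\<close>. The constant is \<open>4 * 8\<close>: the derivative
  of the error in \<open>t\<close> has absolute integral at most \<open>8 * D\<close>, and \<open>\<pi> < 4\<close>.\<close>

lemma interpolation_error_integrals:
  assumes N: "N \<ge> 1" and m: "m \<le> N"
    and chain: "cos_chain (Suc m) \<phi> g" and g: "sq_int 0 pi g"
    and nodes: "\<And>j. j \<le> N \<Longrightarrow> cos_sum b (Suc N) (real j * pi / real N) = \<phi> (real j * pi / real N)"
    and k: "k > 0"
  defines "D \<equiv> fact (N - m) / fact N * sqrt (nsq 0 pi g)"
    and "err \<equiv> norm (integral {0..pi} (\<lambda>t. (\<phi> t - cos_sum b (Suc N) t) * 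
                      (of_real (sin t) * exp (\<i> * of_real (k * cos t)))))"
  shows "err \<le> 32 * D / real N" "err \<le> 32 * D / k" 
    "m \<ge> 1 \<Longrightarrow> err \<le> 32 * (sqrt (real N ^ 5) * D) / k\<^sup>2"
proof -
  obtain \<phi>' where prim: "is_primitive 0 pi \<phi> (\<lambda>t. - of_real (sin t) * \<phi>' t)" and ch: "cos_chain m \<phi>' g"
    using chain by auto
  have D0: "D \<ge> 0" by (simp add: D_def nsq_nonneg)
  have DD: "(fact (N - m) / fact N)\<^sup>2 * nsq 0 pi g = D\<^sup>2"
    unfolding D_def power_mult_distrib by (simp add: nsq_nonneg)
  obtain c where sq': "sq_int 0 pi \<phi>'" and c: "nsq 0 pi (\<lambda>t. \<phi>' t - cos_sum c N t) \<le> D\<^sup>2"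
    and c': "m > 0 \<Longrightarrow> \<exists>\<psi>. is_primitive 0 pi \<phi>' \<psi> \<and> sq_int 0 pi \<psi> \<and> 
         nsq 0 pi (\<lambda>t. \<psi> t - cos_sum_deriv c N t) \<le> (real N)\<^sup>2 * D\<^sup>2"
    using cos_chain_approximation[OF ch g m] unfolding power_mult_distrib[of "real N"] mult.assoc DD by blast
  obtain p where p: "\<And>t. cos_sum_deriv p (Suc N) t = - of_real (sin t) * cos_sum c N t"
    using cos_sum_antiderivative[of N c] by blast
  (* interpolation reproduces P = cos_sum p, so the coefficients d interpolate G = \<phi> - P *)
  define d where "d = (\<lambda>n. b n - p n)"
  define G where "G = (\<lambda>t. \<phi> t - cos_sum p (Suc N) t)"
  define G' where "G' = (\<lambda>t. - complex_of_real (sin t) * (\<phi>' t - cos_sum c N t))"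
  define E where "E = (\<lambda>t. \<phi> t - cos_sum b (Suc N) t)"
  define E' where "E' = (\<lambda>t. G' t - cos_sum_deriv d (Suc N) t)"
  have Gprim: "is_primitive 0 pi G G'"
    unfolding G_def G'_def
    by (rule is_primitive_cong[OF is_primitive_diff[OF prim is_primitive_cos_sum[of _ _ p "Suc N"]]])
       (simp_all add: p algebra_simps)
  have E: "E t = G t - cos_sum d (Suc N) t" for t
    by (simp add: E_def G_def d_def cos_sum_diff)
  have Eprim: "is_primitive 0 pi E E'"
    unfolding E'_def by (rule is_primitive_cong[OF is_primitive_diff[OF Gprim is_primitive_cos_sum[of _ _ d "Suc N"]]])
       (simp_all add: E)
  have sqH: "sq_int 0 pi (\<lambda>t. \<phi>' t - cos_sum c N t)"
    by (intro sq_int_diff sq' sq_int_continuous continuous_intros)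
  have csin: "continuous_on {0..pi} (\<lambda>t. - complex_of_real (sin t))" by (intro continuous_intros)
  have sqG': "sq_int 0 pi G'" "nsq 0 pi G' \<le> D\<^sup>2"
    using sq_int_mult_bounded[OF sqH csin] c unfolding G'_def by auto
  define S where "S = (\<Sum>n\<le>N. (real n * norm (d n))\<^sup>2)"
  have S: "S \<le> pi / 2 * nsq 0 pi G'"
    unfolding S_def
  proof (rule interpolation_stability[OF Gprim sqG'(1) N])
    fix j assume "j \<le> N"
    thus "cos_sum d (Suc N) (real j * pi / real N) = G (real j * pi / real N)"
      using nodes[of j] by (simp add: d_def G_def cos_sum_diff)
  qed
  also have "\<dots> \<le> 2 * D\<^sup>2"
    using sqG'(2) pi_less_4 by (intro mult_mono) (auto simp: nsq_nonneg)
  finally have S: "S \<le> 2 * D\<^sup>2" .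
  have S0: "S \<ge> 0" by (simp add: S_def sum_nonneg)
  have sqE': "sq_int 0 pi E'" and nE': "nsq 0 pi E' \<le> 4\<^sup>2 * D\<^sup>2"
  proof -
    have 1: "sq_int 0 pi (cos_sum_deriv d (Suc N))" by (intro sq_int_continuous continuous_intros)
    show "sq_int 0 pi E'" unfolding E'_def by (rule sq_int_diff(1)[OF sqG'(1) 1])
    have "nsq 0 pi (cos_sum_deriv d (Suc N)) \<le> 2 * (2 * D\<^sup>2)"
      unfolding nsq_cos_sum_deriv S_def[symmetric] using S S0 pi_less_4 by (intro mult_mono) auto
    hence "nsq 0 pi E' \<le> 2 * D\<^sup>2 + 2 * (4 * D\<^sup>2)"
      using sq_int_diff(2)[OF sqG'(1) 1] sqG'(2) unfolding E'_def by linarith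
    also have "\<dots> \<le> 4\<^sup>2 * D\<^sup>2" by simp
    finally show "nsq 0 pi E' \<le> 4\<^sup>2 * D\<^sup>2" .
  qed
  have V: "integral {0..pi} (\<lambda>t. norm (E' t)) \<le> 8 * D"
    using integral_norm_le_of_nsq[OF sqE' nE'] D0 by simp
  have z: "E (real j * pi / real N) = 0" if "j \<le> N" for j
    using nodes[OF that] by (simp add: E_def)
  have E0: "E 0 = 0" "E pi = 0" using z[of 0] z[of N] N by auto
  define osc where "osc = (\<lambda>t. complex_of_real (sin t) * exp (\<i> * of_real (k * cos t)))"
  have err: "err = norm (integral {0..pi} (\<lambda>t. E t * osc t))"
    by (simp add: err_def E_def osc_def)
  have "err \<le> integral {0..pi} (\<lambda>t. norm (E t))"
    unfolding err
  proof (rule integral_norm_bound_integral)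
    have cE: "continuous_on {0..pi} E" by (rule is_primitive_continuous[OF Eprim])
    show "(\<lambda>t. E t * osc t) integrable_on {0..pi}"
      unfolding osc_def by (intro integrable_continuous_real continuous_intros cE)
    show "(\<lambda>t. norm (E t)) integrable_on {0..pi}"
      by (intro integrable_continuous_real continuous_intros cE)
    fix t
    show "norm (E t * osc t) \<le> norm (E t)"
      by (simp add: osc_def norm_mult mult_left_le)
  qed
  also have "\<dots> \<le> pi / real N * integral {0..pi} (\<lambda>t. norm (E' t))"
    by (rule integral_norm_le_of_zeros[OF Eprim N z])
  also have "\<dots> \<le> 4 / real N * (8 * D)"
    using V pi_less_4 N D0 by (intro mult_mono divide_right_mono) (auto intro: integral_nonneg is_primitive_integrable_sub(3)[OF Eprim])
  finally show "err \<le> 32 * D / real N" by simp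
  have "err \<le> (norm (E 0) + norm (E pi) + integral {0..pi} (\<lambda>t. norm (E' t))) / k"
    unfolding err osc_def by (rule osc_by_parts[OF Eprim k])
  also have "\<dots> \<le> 32 * D / k"
    using V k D0 by (intro divide_right_mono) (auto simp: E0)
  finally show "err \<le> 32 * D / k" .
  show "err \<le> 32 * (sqrt (real N ^ 5) * D) / k\<^sup>2" if m1: "m \<ge> 1"
  proof -
    define W where "W = sqrt (real N ^ 5) * D"
    obtain \<psi> where \<psi>: "is_primitive 0 pi \<phi>' \<psi>" "sq_int 0 pi \<psi>" 
        "nsq 0 pi (\<lambda>t. \<psi> t - cos_sum_deriv c N t) \<le> (real N)\<^sup>2 * D\<^sup>2"
      using c' m1 by auto
    obtain q q' where q: "is_primitive 0 pi q q'" "continuous_on {0..pi} q'"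
      "\<And>t. cos_sum_deriv d (Suc N) t = - of_real (sin t) * q t"
      and qb: "\<And>t. norm (q t) \<le> sqrt (real N ^ 5 * S)" "\<And>t. norm (q' t) \<le> sqrt (real N ^ 5 * S)"
      by (rule cos_sum_slope[of d N, folded S_def]) (rule that)
    have ND: "real N * D \<le> W"
    proof -
      have "real N ^ 2 \<le> real N ^ 5" using N by (intro power_increasing) auto
      hence "real N \<le> sqrt (real N ^ 5)" by (intro real_le_rsqrt)
      thus ?thesis unfolding W_def using D0 by (intro mult_right_mono)
    qed
    have D_ND: "D \<le> real N * D" using N D0 mult_right_mono[of 1 "real N" D] by simp
    have "sqrt (real N ^ 5 * S) \<le> sqrt (real N ^ 5 * (2\<^sup>2 * D\<^sup>2))"
      using order_trans[OF S, of "2\<^sup>2 * D\<^sup>2"] by (intro real_sqrt_le_mono mult_left_mono) auto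
    also have "\<dots> = 2 * W"
      using D0 by (simp add: real_sqrt_mult W_def)
    finally have Q: "sqrt (real N ^ 5 * S) \<le> 2 * W" .
    define H where "H = (\<lambda>t. \<phi>' t - cos_sum c N t)"
    define H' where "H' = (\<lambda>t. \<psi> t - cos_sum_deriv c N t)"
    have Hprim: "is_primitive 0 pi H H'"
      unfolding H_def H'_def by (intro is_primitive_diff \<psi> is_primitive_cos_sum)
    have sqH': "sq_int 0 pi H'"
      unfolding H'_def by (intro sq_int_diff \<psi> sq_int_continuous continuous_intros)
    have iH': "integral {0..pi} (\<lambda>t. norm (H' t)) \<le> 2 * real N * D"
      using \<psi>(3) D0 by (intro integral_norm_le_of_nsq[OF sqH']) (auto simp: H'_def)
    have iH: "integral {0..pi} (\<lambda>t. norm (H t)) \<le> 2 * 1 * D"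
      unfolding H_def using c D0 by (intro integral_norm_le_of_nsq[OF sqH]) auto
    have Hx: "norm (H x) \<le> 3 * W" if "x \<in> {0..pi}" for x
    proof -
      have "pi * norm (H x) \<le> integral {0..pi} (\<lambda>t. norm (H t)) + pi * integral {0..pi} (\<lambda>t. norm (H' t))"
        by (rule norm_le_average_plus_variation[OF Hprim that])
      also have "\<dots> \<le> pi * D + pi * (2 * real N * D)"
      proof (intro add_mono mult_left_mono iH')
        have "2 * D \<le> pi * D" using pi_gt3 D0 by (intro mult_right_mono) auto
        thus "integral {0..pi} (\<lambda>t. norm (H t)) \<le> pi * D" using iH by linarith
      qed auto
      also have "\<dots> = pi * (D + 2 * (real N * D))" by (simp add: algebra_simps)
      finally have "norm (H x) \<le> D + 2 * (real N * D)" by (simp only: mult_le_cancel_left_pos[OF pi_gt_zero])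
      thus ?thesis using ND D_ND by linarith
    qed
    (* E1 is the derivative of the error with respect to x = cos t: the factor sin t in E' restores
       the kernel, so the integral left by the first integration by parts is again oscillatory *)
    define E1 where "E1 = (\<lambda>t. H t - q t)"
    define E1' where "E1' = (\<lambda>t. H' t - q' t)"
    have E1prim: "is_primitive 0 pi E1 E1'"
      unfolding E1_def E1'_def by (intro is_primitive_diff Hprim q)
    have E'E1: "E' t = - of_real (sin t) * E1 t" for t
      by (simp add: E'_def G'_def E1_def H_def q(3) algebra_simps)
    have E1x: "norm (E1 x) \<le> 5 * W" if "x \<in> {0..pi}" for x
      using norm_triangle_ineq4[of "H x" "q x"] Hx[OF that] qb(1)[of x] Q unfolding E1_def by linarith
    have iq': "integral {0..pi} (\<lambda>t. norm (q' t)) \<le> pi * (2 * W)"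
    proof -
      have "integral {0..pi} (\<lambda>t. norm (q' t)) \<le> integral {0..pi} (\<lambda>t. 2 * W)"
        using qb(2) Q by (intro integral_le integrable_continuous_real continuous_intros q(2)) (auto intro: order_trans)
      thus ?thesis by simp
    qed
    have "integral {0..pi} (\<lambda>t. norm (E1' t)) \<le> integral {0..pi} (\<lambda>t. norm (H' t) + norm (q' t))"
      using is_primitive_integrable_sub(3)[OF Hprim, of 0 pi] is_primitive_integrable_sub(3)[OF q(1), of 0 pi]
        is_primitive_integrable_sub(3)[OF E1prim, of 0 pi] unfolding E1'_def
      by (intro integral_le Henstock_Kurzweil_Integration.integrable_add norm_triangle_ineq4) auto
    also have "\<dots> = integral {0..pi} (\<lambda>t. norm (H' t)) + integral {0..pi} (\<lambda>t. norm (q' t))"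
      using is_primitive_integrable_sub(3)[OF Hprim, of 0 pi] is_primitive_integrable_sub(3)[OF q(1), of 0 pi]
      by (intro Henstock_Kurzweil_Integration.integral_add) auto
    also have "\<dots> \<le> 2 * W + 8 * W"
    proof -
      have "pi * (2 * W) \<le> 4 * (2 * W)" using pi_less_4 ND D0 D_ND by (intro mult_right_mono) linarith+
      thus ?thesis using iH' iq' ND by linarith
    qed
    finally have iE1': "integral {0..pi} (\<lambda>t. norm (E1' t)) \<le> 10 * W" by simp
    define v where "v = (\<lambda>t. exp (\<i> * complex_of_real (k * cos t)))"
    define I1 where "I1 = norm (integral {0..pi} (\<lambda>t. E1 t * osc t))"
    have "I1 \<le> (norm (E1 0) + norm (E1 pi) + integral {0..pi} (\<lambda>t. norm (E1' t))) / k"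
      unfolding I1_def osc_def by (rule osc_by_parts[OF E1prim k])
    also have "\<dots> \<le> 20 * W / k"
      using E1x[of 0] E1x[of pi] iE1' k by (intro divide_right_mono) auto
    finally have I1: "I1 \<le> 20 * W / k" .
    have "integral {0..pi} (\<lambda>t. E' t * v t) = - integral {0..pi} (\<lambda>t. E1 t * osc t)"
      unfolding integral_neg[symmetric] by (rule integral_cong) (simp add: E'E1 osc_def v_def mult_ac)
    hence "err = I1 / k"
      using k unfolding err osc_def I1_def osc_by_parts_eq[OF Eprim k] v_def
      by (simp add: E0 norm_mult norm_divide)
    also have "\<dots> \<le> 20 * W / k / k" using I1 k by (intro divide_right_mono) auto
    also have "\<dots> \<le> 32 * W / k\<^sup>2"
      using k ND D_ND D0 by (simp add: power2_eq_square divide_right_mono)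
    finally show ?thesis by (simp add: W_def)
  qed
qed

section \<open>The substitution \<open>x = cos t\<close> and the interpolating polynomial\<close>

lemma cos_image_Icc:
  assumes "\<theta> \<in> {0..pi}"
  shows "cos ` {0..\<theta>} = {cos \<theta>..1}"
proof safe
  fix x assume "x \<in> {cos \<theta>..1}"
  hence x: "-1 \<le> x" "x \<le> 1" "cos \<theta> \<le> x" by (auto intro: order_trans[OF cos_ge_minus_one])
  have "arccos x \<le> arccos (cos \<theta>)" using x by (intro arccos_le_arccos) auto
  hence "arccos x \<in> {0..\<theta>}" using assms x by (auto simp: arccos_cos arccos_lbound)
  thus "x \<in> cos ` {0..\<theta>}" using x by (intro image_eqI[of _ _ "arccos x"]) auto
qed (use assms in \<open>auto intro: cos_monotone_0_pi_le\<close>)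

lemma cos_substitution:
  fixes F :: "real \<Rightarrow> 'a :: euclidean_space"
  assumes F: "F absolutely_integrable_on {-1..1}" and \<theta>: "\<theta> \<in> {0..pi}"
  shows "(\<lambda>t. sin t *\<^sub>R F (cos t)) absolutely_integrable_on {0..\<theta>}"
    and "integral {0..\<theta>} (\<lambda>t. sin t *\<^sub>R F (cos t)) = integral {cos \<theta>..1} F"
proof -
  have der: "(cos has_field_derivative - sin t) (at t within {0..\<theta>})" for t
    by (auto intro!: derivative_eq_intros)
  have inj: "inj_on cos {0..\<theta>}"
    using \<theta> by (auto simp: inj_on_def intro: cos_inj_pi)
  have "F absolutely_integrable_on {cos \<theta>..1}"
    using F by (rule absolutely_integrable_on_subinterval) (use \<theta> in auto)
  hence *: "(\<lambda>t. \<bar>- sin t\<bar> *\<^sub>R F (cos t)) absolutely_integrable_on {0..\<theta>} \<and>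
     integral {0..\<theta>} (\<lambda>t. \<bar>- sin t\<bar> *\<^sub>R F (cos t)) = integral {cos \<theta>..1} F"
    by (subst has_absolute_integral_change_of_variables_real[OF _ der inj]) (simp_all add: cos_image_Icc[OF \<theta>])
  have eq: "\<bar>- sin t\<bar> *\<^sub>R F (cos t) = sin t *\<^sub>R F (cos t)" if "t \<in> {0..\<theta>}" for t
    using that \<theta> sin_ge_zero[of t] by auto
  show "(\<lambda>t. sin t *\<^sub>R F (cos t)) absolutely_integrable_on {0..\<theta>}"
  proof (rule absolutely_integrable_spike[OF conjunct1[OF *], of "{}"])
    show "sin t *\<^sub>R F (cos t) = \<bar>- sin t\<bar> *\<^sub>R F (cos t)" if "t \<in> {0..\<theta>} - {}" for t
      using eq[of t] that by (simp only: Diff_empty)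
  qed simp
  have "integral {0..\<theta>} (\<lambda>t. sin t *\<^sub>R F (cos t)) = integral {0..\<theta>} (\<lambda>t. \<bar>- sin t\<bar> *\<^sub>R F (cos t))"
    by (rule integral_cong) (rule eq[symmetric])
  thus "integral {0..\<theta>} (\<lambda>t. sin t *\<^sub>R F (cos t)) = integral {cos \<theta>..1} F"
    using * by simp
qed

lemma is_primitive_compose_cos:
  assumes "is_primitive (-1) 1 f f'"
  shows "is_primitive 0 pi (\<lambda>t. f (cos t)) (\<lambda>t. - of_real (sin t) * f' (cos t))"
  unfolding is_primitive_def
proof (intro conjI ballI)
  note F = is_primitiveD(1)[OF assms]
  have eq: "(\<lambda>t. - of_real (sin t) * f' (cos t)) = (\<lambda>t. - (sin t *\<^sub>R f' (cos t)))"
    by (simp add: scaleR_conv_of_real)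
  show "(\<lambda>t. - of_real (sin t) * f' (cos t)) absolutely_integrable_on {0..pi}"
    unfolding eq using cos_substitution(1)[OF F, of pi] absolutely_integrable_scaleR_left[where c = "-1"] by fastforce
  fix \<theta> assume \<theta>: "\<theta> \<in> {0..pi}"
  have "f 1 - f (cos \<theta>) = integral {0..\<theta>} (\<lambda>t. sin t *\<^sub>R f' (cos t))"
    using is_primitive_increment(1)[OF assms, of "cos \<theta>" 1] cos_substitution(2)[OF F \<theta>] by simp
  thus "f (cos \<theta>) = f (cos 0) + integral {0..\<theta>} (\<lambda>t. - of_real (sin t) * f' (cos t))"
    unfolding eq by (simp add: algebra_simps)
qed

lemma is_deriv_Suc_iff: 
  "is_deriv a b (Suc m) f g \<longleftrightarrow> (\<exists>f'. is_primitive a b f f' \<and> is_deriv a b m f' g)"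
  by (simp add: is_primitive_def)

lemma is_deriv_imp_cos_chain:
  "is_deriv (-1) 1 m f g \<Longrightarrow> cos_chain m (\<lambda>t. f (cos t)) (\<lambda>t. g (cos t))"
proof (induction m arbitrary: f)
  case (Suc m)
  then obtain f' where "is_primitive (-1) 1 f f'" "is_deriv (-1) 1 m f' g"
    unfolding is_deriv_Suc_iff by blast
  thus ?case unfolding cos_chain.simps
    by (intro exI[of _ "\<lambda>t. f' (cos t)"] conjI is_primitive_compose_cos Suc.IH)
qed simp

lemma is_deriv_absolutely_integrable:
  "is_deriv a b (Suc m) f g \<Longrightarrow> g absolutely_integrable_on {a..b}"
proof (induction m arbitrary: f)
  case 0
  thus ?case unfolding is_deriv_Suc_iff
    by (auto dest!: is_primitiveD(1) intro: absolutely_integrable_spike[where S="{}"])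
next
  case (Suc m)
  thus ?case unfolding is_deriv_Suc_iff[of a b "Suc m"] by blast
qed

text \<open>The Chebyshev weight cancels the Jacobian \<open>sin t\<close>, except at the two end points, where the
  weighted integrand takes the value \<open>0\<close> of a division by zero.\<close>

lemma weighted_square_integral_cos:
  assumes g: "g absolutely_integrable_on {-1..1}"
    and w: "(\<lambda>x. (norm (g x))\<^sup>2 / sqrt ((1 - x) * (x - (-1)))) integrable_on {-1..1}"
  shows "sq_int 0 pi (\<lambda>t. g (cos t))"
    and "nsq 0 pi (\<lambda>t. g (cos t)) = integral {-1..1} (\<lambda>x. (norm (g x))\<^sup>2 / sqrt ((1 - x) * (x - (-1))))"
proof -
  let ?w = "\<lambda>x. (norm (g x))\<^sup>2 / sqrt ((1 - x) * (x - (-1)))"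
  have wa: "?w absolutely_integrable_on {-1..1}"
    using w by (rule nonnegative_absolutely_integrable_1) simp
  have eq: "sin t *\<^sub>R ?w (cos t) = (norm (g (cos t)))\<^sup>2" if "t \<in> {0..pi} - {0, pi}" for t
  proof -
    have s: "sin t > 0" using that by (intro sin_gt_zero) auto
    have "(1 - cos t) * (cos t - (-1)) = (sin t)\<^sup>2"
      by (simp add: sin_squared_eq power2_eq_square algebra_simps)
    thus ?thesis using s by simp
  qed
  have i1: "(\<lambda>t. sin t *\<^sub>R ?w (cos t)) integrable_on {0..pi}"
    using cos_substitution(1)[OF wa, of pi] by (simp add: absolutely_integrable_on_def)
  have i: "(\<lambda>t. (norm (g (cos t)))\<^sup>2) integrable_on {0..pi}"
    by (rule integrable_spike_finite[OF _ _ i1, of "{0, pi}"]) (use eq in auto)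
  have "nsq 0 pi (\<lambda>t. g (cos t)) = integral {0..pi} (\<lambda>t. sin t *\<^sub>R ?w (cos t))"
    unfolding nsq_def by (rule integral_spike[of "{0, pi}"]) (use eq in auto)
  also have "\<dots> = integral {-1..1} ?w" using cos_substitution(2)[OF wa, of pi] by simp
  finally show "nsq 0 pi (\<lambda>t. g (cos t)) = integral {-1..1} ?w" .
  have "(\<lambda>t. sin t *\<^sub>R g (cos t)) \<in> borel_measurable (lebesgue_on {0..pi})"
    using cos_substitution(1)[OF g, of pi] by (intro absolutely_integrable_imp_borel_measurable) auto
  moreover have "(\<lambda>t. inverse (sin t)) \<in> borel_measurable (lebesgue_on {0..pi})"
    by (intro borel_measurable_inverse continuous_imp_measurable_on_sets_lebesgue continuous_intros) auto
  ultimately have "(\<lambda>t. inverse (sin t) *\<^sub>R (sin t *\<^sub>R g (cos t))) \<in> borel_measurable (lebesgue_on {0..pi})"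
    by (rule borel_measurable_scaleR[rotated])
  hence "(\<lambda>t. g (cos t)) \<in> borel_measurable (lebesgue_on {0..pi})"
  proof (rule measurable_discrete_difference[where X = "{0, pi}"])
    fix t assume "t \<in> space (lebesgue_on {0..pi})" "t \<notin> {0, pi}"
    hence "sin t > 0" by (intro sin_gt_zero) auto
    thus "inverse (sin t) *\<^sub>R (sin t *\<^sub>R g (cos t)) = g (cos t)" by simp
  qed (auto simp: sets_restrict_space_iff)
  thus "sq_int 0 pi (\<lambda>t. g (cos t))" using i by (simp add: sq_int_def)
qed

lemma interpolation_poly_exists:
  fixes x y :: "nat \<Rightarrow> 'a :: field"
  assumes "inj_on x {..N}"
  shows "\<exists>p. degree p \<le> N \<and> (\<forall>j\<le>N. poly p (x j) = y j)"
  using assms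
proof (induction N)
  case 0
  show ?case by (rule exI[of _ "[:y 0:]"]) simp
next
  case (Suc N)
  have "inj_on x {..N}" by (rule inj_on_subset[OF Suc.prems]) auto
  from Suc.IH[OF this] obtain p where p: "degree p \<le> N" "\<forall>j\<le>N. poly p (x j) = y j"
    by blast
  define w where "w = (\<Prod>j\<le>N. [:- x j, 1:])"
  have deg: "degree w \<le> Suc N"
    unfolding w_def by (rule order_trans[OF degree_prod_sum_le]) simp_all
  have w0: "poly w (x j) = 0" if "j \<le> N" for j
    using that by (auto simp: w_def poly_prod)
  have w1: "poly w (x (Suc N)) \<noteq> 0"
  proof -
    have "x (Suc N) \<noteq> x j" if "j \<le> N" for j
      using inj_onD[OF Suc.prems, of "Suc N" j] that by auto
    thus ?thesis by (auto simp: w_def poly_prod)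
  qed
  let ?q = "p + smult ((y (Suc N) - poly p (x (Suc N))) / poly w (x (Suc N))) w"
  have "degree ?q \<le> Suc N"
    using p(1) deg by (intro degree_add_le) (auto intro: order_trans[OF degree_smult_le])
  moreover have "poly ?q (x j) = y j" if "j \<le> Suc N" for j
    using p(2) w0 w1 that by (cases "j = Suc N") auto
  ultimately show ?case by blast
qed

lemma interpolation_poly_unique:
  fixes x :: "nat \<Rightarrow> 'a :: field"
  assumes inj: "inj_on x {..N}" and "degree p \<le> N" "degree q \<le> N"
    and "\<And>j. j \<le> N \<Longrightarrow> poly p (x j) = poly q (x j)"
  shows "p = q"
proof (rule poly_eqI_degree)
  show "poly p z = poly q z" if "z \<in> x ` {..N}" for z using that assms(4) by auto
  show "degree p < card (x ` {..N})" "degree q < card (x ` {..N})"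
    using assms(2,3) inj by (auto simp: card_image)
qed

lemma cc_interp:
  assumes N: "N \<ge> 1"
  shows "degree (cc_interp N f) \<le> N"
    and "j \<le> N \<Longrightarrow> poly (cc_interp N f) (of_real (cc_node N j)) = f (cc_node N j)"
proof -
  have inj: "inj_on (\<lambda>j. complex_of_real (cc_node N j)) {..N}"
  proof (rule inj_onI)
    fix i j assume ij: "i \<in> {..N}" "j \<in> {..N}" "complex_of_real (cc_node N i) = complex_of_real (cc_node N j)"
    have le: "real j * pi / real N \<le> pi" if "j \<in> {..N}" for j
      using that N by (simp add: divide_le_eq)
    have "cos (real i * pi / real N) = cos (real j * pi / real N)"
      using ij(3) by (simp add: cc_node_def)
    hence "real i * pi / real N = real j * pi / real N"
      by (rule cos_inj_pi[OF _ le[OF ij(1)] _ le[OF ij(2)], rotated 2]) simp_all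
    thus "i = j" using N by simp
  qed
  have "\<exists>!p. degree p \<le> N \<and> (\<forall>j\<le>N. poly p (of_real (cc_node N j)) = f (cc_node N j))"
  proof (rule ex_ex1I)
    show "\<exists>p. degree p \<le> N \<and> (\<forall>j\<le>N. poly p (of_real (cc_node N j)) = f (cc_node N j))"
      by (rule interpolation_poly_exists[OF inj])
    show "p = q" if "degree p \<le> N \<and> (\<forall>j\<le>N. poly p (of_real (cc_node N j)) = f (cc_node N j))"
      "degree q \<le> N \<and> (\<forall>j\<le>N. poly q (of_real (cc_node N j)) = f (cc_node N j))" for p q
      using that by (intro interpolation_poly_unique[OF inj]) auto
  qed
  from theI'[OF this] show "degree (cc_interp N f) \<le> N"
    and "j \<le> N \<Longrightarrow> poly (cc_interp N f) (of_real (cc_node N j)) = f (cc_node N j)"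
    unfolding cc_interp_def[symmetric] by auto
qed

text \<open>The products agree factor by factor except that \<open>N\<close> appears in place of \<open>N + 1\<close> in the
  numerator.\<close>

lemma fcc_sigma_ge:
  assumes "s \<le> N" "N \<ge> 1"
  shows "fact (N - s) / fact N * real N ^ s \<le> fcc_sigma (Suc s) N"
  using assms(1)
proof (induction s)
  case (Suc s)
  have pos: "real N - real s > 0" using Suc.prems by simp
  have "N - s = Suc (N - Suc s)" using Suc.prems by simp
  hence "fact (N - s) = (real N - real s) * fact (N - Suc s)"
    using Suc.prems by (simp add: of_nat_diff)
  hence "fact (N - Suc s) = fact (N - s) / (real N - real s)" using pos by simp
  hence "fact (N - Suc s) / fact N * real N ^ Suc s = (fact (N - s) / fact N * real N ^ s) * (real N / (real N - real s))"
    by (simp add: mult_ac)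
  also have "\<dots> \<le> fcc_sigma (Suc s) N * ((real N + 1) / (real N - real s))"
    using Suc pos by (intro mult_mono divide_right_mono Suc.IH) 
      (auto simp: fcc_sigma_def intro!: prod_nonneg)
  also have "\<dots> = fcc_sigma (Suc (Suc s)) N"
    by (simp add: fcc_sigma_def prod.nat_ivl_Suc')
  finally show ?case .
qed (simp add: fcc_sigma_def)

lemma le_geometric_interpolation:
  fixes x b u v t :: real
  assumes "x \<le> b * u" "x \<le> b * v" "0 \<le> b" "0 < u" "0 < v" "0 \<le> t" "t \<le> 1"
  shows "x \<le> b * (u powr (1 - t) * v powr t)"
proof -
  have "x \<le> b * min u v" using assms(1-2) by (simp add: min_def)
  also have "min u v = min u v powr (1 - t) * min u v powr t"
    using assms by (simp add: powr_add[symmetric])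
  also have "\<dots> \<le> u powr (1 - t) * v powr t"
    using assms by (intro mult_mono powr_mono2) auto
  finally show ?thesis using assms by (simp add: mult_left_mono)
qed

section \<open>The bound on the reference interval\<close>

lemma Hw_is_deriv:
  assumes "f \<in> Hw a b m"
  shows "is_deriv a b m f (nth_derivative a b m f)"
  using assms someI_ex[of "is_deriv a b m f"] unfolding Hw_def nth_derivative_def by blast

text \<open>The three error bounds combine geometrically: zero and one integration by parts for
  \<open>r \<le> 1\<close>, one and two for \<open>r \<ge> 1\<close>.\<close>

lemma fcc_ref_bound_explicit:
  assumes r: "0 \<le> r" "r \<le> 2" "r \<le> real m" and N: "1 \<le> N" and m: "1 \<le> m" "m \<le> N + 1" and k: "1 / 2 \<le> k"
  shows "fcc_ref_bound r m N k (32 * fcc_sigma m N)"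
  unfolding fcc_ref_bound_def
proof
  fix f assume f: "f \<in> Hw (-1) 1 m"
  obtain s where s: "m = Suc s" "s \<le> N" using m by (cases m) auto
  have k0: "k > 0" using k by simp
  define g where "g = nth_derivative (-1) 1 m f"
  have deriv: "is_deriv (-1) 1 (Suc s) f g"
    using Hw_is_deriv[OF f] by (simp only: s g_def)
  have w: "(\<lambda>x. (norm (g x))\<^sup>2 / sqrt ((1 - x) * (x - (-1)))) integrable_on {-1..1}"
    using f unfolding Hw_def mem_Collect_eq Hw_integrand_def[abs_def] g_def by blast
  note gs = weighted_square_integral_cos[OF is_deriv_absolutely_integrable[OF deriv] w]
  define A where "A = Hw_seminorm (-1) 1 m f"
  have A: "A = sqrt (nsq 0 pi (\<lambda>t. g (cos t)))"
    unfolding A_def Hw_seminorm_def Hw_integrand_def[abs_def] g_def[symmetric] gs(2) ..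
  have A0: "A \<ge> 0" by (simp add: A nsq_nonneg)
  note chain = is_deriv_imp_cos_chain[OF deriv]
  obtain f' where f': "is_primitive (-1) 1 f f'" using deriv unfolding is_deriv_Suc_iff by blast
  have cf: "continuous_on {-1..1} f" by (rule is_primitive_continuous[OF f'])
  define Q where "Q = cc_interp N f"
  have "(\<lambda>t. poly Q (of_real (cos t))) \<in> cos_polys (Suc N)"
    using lin_combs_mono[OF poly_cos_in_cos_polys[of Q]] cc_interp(1)[OF N, of f] by (auto simp: Q_def)
  then obtain b where b: "(\<lambda>t. poly Q (of_real (cos t))) = cos_sum b (Suc N)"
    unfolding cos_polys_cos_sum by blast
  have nodes: "cos_sum b (Suc N) (real j * pi / real N) = f (cos (real j * pi / real N))" if "j \<le> N" for j
    using cc_interp(2)[OF N that, of f] unfolding fun_cong[OF b, symmetric] by (simp add: Q_def cc_node_def)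
  define err where "err = norm (osc_integral (-1) 1 k f - fcc_ref k N f)"
  have err: "err = norm (integral {0..pi} (\<lambda>t. (f (cos t) - cos_sum b (Suc N) t) * 
                      (of_real (sin t) * exp (\<i> * of_real (k * cos t)))))"
  proof -
    have cQ: "continuous_on {-1..1} (\<lambda>x. poly Q (complex_of_real x))" by (intro continuous_intros)
    have c: "continuous_on {-1..1} (\<lambda>x. (f x - poly Q (of_real x)) * exp (\<i> * of_real (k * x)))"
      by (intro continuous_intros cf)
    have "osc_integral (-1) 1 k f - fcc_ref k N f = 
        integral {-1..1} (\<lambda>x. f x * exp (\<i> * of_real (k * x)) - poly Q (of_real x) * exp (\<i> * of_real (k * x)))"
      unfolding osc_integral_def fcc_ref_def Q_def[symmetric] using k
      by (subst Henstock_Kurzweil_Integration.integral_diff)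
         (auto intro!: integrable_continuous_real continuous_intros cf)
    also have "\<dots> = integral {cos pi..1} (\<lambda>x. (f x - poly Q (of_real x)) * exp (\<i> * of_real (k * x)))"
      by (simp add: algebra_simps)
    also have "\<dots> = integral {0..pi} (\<lambda>t. sin t *\<^sub>R ((f (cos t) - poly Q (of_real (cos t))) * exp (\<i> * of_real (k * cos t))))"
      by (rule cos_substitution(2)[OF absolutely_integrable_continuous_real[OF c], symmetric]) simp
    also have "\<dots> = integral {0..pi} (\<lambda>t. (f (cos t) - cos_sum b (Suc N) t) * 
                      (of_real (sin t) * exp (\<i> * of_real (k * cos t))))"
      unfolding fun_cong[OF b, symmetric] by (simp add: scaleR_conv_of_real mult_ac)
    finally show ?thesis by (simp add: err_def)
  qed
  define D where "D = fact (N - s) / fact N * A"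
  have bounds: "err \<le> 32 * D / real N" "err \<le> 32 * D / k" "s \<ge> 1 \<Longrightarrow> err \<le> 32 * (sqrt (real N ^ 5) * D) / k\<^sup>2"
    by (rule interpolation_error_integrals[OF N s(2) chain gs(1) _ k0, where b = b, folded A err, folded D_def];
        simp add: nodes)+
  define B where "B = 32 * (fcc_sigma m N * A * (1 / real N) ^ s)"
  have DB: "32 * D \<le> B"
  proof -
    have "fact (N - s) / fact N \<le> fcc_sigma m N * (1 / real N) ^ s"
      using fcc_sigma_ge[OF s(2) N] N by (simp add: s(1) power_one_over field_simps)
    from mult_left_mono[OF mult_right_mono[OF this A0], of 32] show ?thesis
      by (simp add: D_def B_def mult_ac)
  qed
  have D0: "D \<ge> 0" using A0 by (simp add: D_def)
  have B0: "B \<ge> 0" using DB D0 by linarith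
  have N0: "real N > 0" using N by simp
  have e0: "err \<le> B * (1 / real N)" 
    using order_trans[OF bounds(1) divide_right_mono[OF DB, of "real N"]] by simp
  have e1: "err \<le> B * (1 / k)" 
    using order_trans[OF bounds(2) divide_right_mono[OF DB, of k]] k0 by simp
  have pow_s: "(1 / real N) ^ s = (1 / real N) powr real s"
    using N0 by (simp add: powr_realpow)
  have "err \<le> 32 * fcc_sigma m N * (1 / k) powr r * (1 / real N) powr (real m - rho r) * A"
  proof (cases "r \<le> 1")
    case True
    have "err \<le> B * ((1 / real N) powr (1 - r) * (1 / k) powr r)"
      using r True N0 k0 by (intro le_geometric_interpolation e0 e1 B0) auto
    also have "\<dots> = 32 * fcc_sigma m N * (1 / k) powr r * ((1 / real N) powr real s * (1 / real N) powr (1 - r)) * A"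
      by (simp add: B_def pow_s mult_ac)
    also have "(1 / real N) powr real s * (1 / real N) powr (1 - r) = (1 / real N) powr (real m - rho r)"
      unfolding powr_add[symmetric] using True by (simp add: rho_def s algebra_simps)
    finally show ?thesis .
  next
    case False
    hence s1: "s \<ge> 1" using r(3) s by (cases s) auto
    have "err \<le> 32 * D * (sqrt (real N ^ 5) / k\<^sup>2)"
      using bounds(3)[OF s1] by (simp add: mult_ac)
    also have "\<dots> \<le> B * (sqrt (real N ^ 5) / k\<^sup>2)"
      using DB by (intro mult_right_mono) auto
    finally have e2: "err \<le> B * (sqrt (real N ^ 5) / k\<^sup>2)" .
    have "err \<le> B * ((1 / k) powr (1 - (r - 1)) * (sqrt (real N ^ 5) / k\<^sup>2) powr (r - 1))"
      using r False N0 k0 by (intro le_geometric_interpolation e1 e2 B0) auto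
    also have "sqrt (real N ^ 5) / k\<^sup>2 = (1 / real N) powr (-5/2) * (1 / k) powr 2"
    proof -
      have "sqrt (real N ^ 5) = (real N powr 5) powr (1 / 2)"
        using N0 powr_realpow[of "real N" 5] by (simp add: powr_half_sqrt)
      also have "\<dots> = real N powr (5 / 2)" by (subst powr_powr) simp
      also have "\<dots> = (1 / real N) powr (-5/2)"
        using N0 powr_minus_divide[of "real N" "- 5 / 2"] by (simp add: powr_powr powr_divide powr_minus field_simps)
      finally show ?thesis using k0 by (simp add: power_one_over powr_numeral)
    qed
    also have "(1 / k) powr (1 - (r - 1)) * ((1 / real N) powr (-5/2) * (1 / k) powr 2) powr (r - 1) =
        (1 / k) powr r * (1 / real N) powr (-5/2 * (r - 1))"
    proof -
      have "(1 / k) powr (1 - (r - 1)) * ((1 / real N) powr (-5/2) * (1 / k) powr 2) powr (r - 1) = 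
         ((1 / k) powr (1 - (r - 1)) * (1 / k) powr (2 * (r - 1))) * (1 / real N) powr (-5/2 * (r - 1))"
        using k0 N0 by (simp add: powr_mult powr_powr mult_ac del: powr_numeral)
      thus ?thesis unfolding powr_add[symmetric] by (simp add: algebra_simps)
    qed
    also have "B * ((1 / k) powr r * (1 / real N) powr (-5/2 * (r - 1))) = 
       32 * fcc_sigma m N * (1 / k) powr r * ((1 / real N) powr real s * (1 / real N) powr (-5/2 * (r - 1))) * A"
      by (simp add: B_def pow_s mult_ac)
    also have "(1 / real N) powr real s * (1 / real N) powr (-5/2 * (r - 1)) = (1 / real N) powr (real m - rho r)"
      unfolding powr_add[symmetric] using False by (simp add: rho_def s field_simps)
    finally show ?thesis .
  qed
  thus "norm (osc_integral (-1) 1 k f - fcc_ref k N f) \<le> 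
     32 * fcc_sigma m N * (1 / k) powr r * (1 / real N) powr (real m - rho r) * Hw_seminorm (-1) 1 m f"
    by (simp add: err_def A_def)
qed

section \<open>Uniqueness of derivatives\<close>

lemma is_primitive_unique:
  assumes "is_primitive a b f u" "is_primitive a b f v"
  shows "negligible {x \<in> {a..b}. u x \<noteq> v x}"
proof -
  have p: "is_primitive a b (\<lambda>x. f x - f x) (\<lambda>x. u x - v x)" by (rule is_primitive_diff[OF assms])
  have "negligible {x \<in> {a..b}. u x - v x \<noteq> 0}"
  proof (rule vanishing_indefinite_integral_imp_negligible)
    show "(\<lambda>x. u x - v x) integrable_on {a..b}" by (rule is_primitive_integrable_sub(2)[OF p]) auto
    show "integral {a..x} (\<lambda>x. u x - v x) = 0" if "x \<in> {a..b}" for x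
      using is_primitive_increment(1)[OF p, of a x] that by auto
  qed
  thus ?thesis by simp
qed

lemma continuous_eq_of_negligible:
  fixes u v :: "real \<Rightarrow> complex"
  assumes ab: "a < b" and c: "continuous_on {a..b} u" "continuous_on {a..b} v" 
    and n: "negligible {x \<in> {a..b}. u x \<noteq> v x}" and x: "x \<in> {a..b}"
  shows "u x = v x"
proof -
  have cn: "continuous_on {a..b} (\<lambda>x. norm (u x - v x))" by (intro continuous_intros c)
  have "integral {a..b} (\<lambda>x. norm (u x - v x)) = integral {a..b} (\<lambda>x. 0)"
    by (rule integral_spike[OF n]) auto
  hence "((\<lambda>x. norm (u x - v x)) has_integral 0) (cbox a b)"
    using integrable_integral[OF integrable_continuous_real[OF cn]] by simp
  hence "norm (u x - v x) = 0"
    using x ab cn by (intro has_integral_0_cbox_imp_0[of a b "\<lambda>x. norm (u x - v x)"]) auto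
  thus ?thesis by simp
qed

lemma is_deriv_cong:
  assumes "is_deriv a b m f g" "\<And>x. x \<in> {a..b} \<Longrightarrow> f' x = f x"
  shows "is_deriv a b m f' g"
proof (cases m)
  case 0
  thus ?thesis using assms by auto
next
  case (Suc n)
  obtain u where "is_primitive a b f u" "is_deriv a b n u g"
    using assms(1) unfolding Suc is_deriv_Suc_iff by blast
  thus ?thesis unfolding Suc is_deriv_Suc_iff 
    using is_primitive_cong[of a b f u f' u] assms(2) by blast
qed

text \<open>For order at least one the last derivative is determined up to a null set, and all
  intermediate derivatives are determined everywhere because they are continuous.\<close>

lemma is_deriv_unique:
  assumes "is_deriv a b m f g" "is_deriv a b m f h" "a < b"
  shows "negligible {x \<in> {a..b}. g x \<noteq> h x}"
  using assms(1,2)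
proof (induction m arbitrary: f)
  case 0
  hence "{x \<in> {a..b}. g x \<noteq> h x} = {}" by auto
  thus ?case by (simp only: negligible_empty)
next
  case (Suc m)
  obtain u where u: "is_primitive a b f u" "is_deriv a b m u g" using Suc.prems(1) unfolding is_deriv_Suc_iff by blast
  obtain v where v: "is_primitive a b f v" "is_deriv a b m v h" using Suc.prems(2) unfolding is_deriv_Suc_iff by blast
  note n = is_primitive_unique[OF u(1) v(1)]
  show ?case
  proof (cases m)
    case 0
    have "{x \<in> {a..b}. g x \<noteq> h x} = {x \<in> {a..b}. u x \<noteq> v x}" using u(2) v(2) 0 by auto
    thus ?thesis using n by simp
  next
    case (Suc n')
    have "continuous_on {a..b} u" "continuous_on {a..b} v"
      using u(2) v(2) unfolding Suc is_deriv_Suc_iff by (auto intro: is_primitive_continuous)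
    hence "u x = v x" if "x \<in> {a..b}" for x
      using continuous_eq_of_negligible[OF assms(3) _ _ n that] by blast
    hence "is_deriv a b m u h" using is_deriv_cong[OF v(2)] by blast
    thus ?thesis using Suc.IH u(2) by blast
  qed
qed

section \<open>Affine change of interval\<close>

lemma affine_in_Icc:
  fixes a b :: real
  assumes "a < b" "t \<in> {-1..1}"
  shows "(a + b) / 2 + (b - a) / 2 * t \<in> {a..b}"
proof -
  have "(b - a) / 2 * (-1) \<le> (b - a) / 2 * t" "(b - a) / 2 * t \<le> (b - a) / 2 * 1" 
    using assms by (intro mult_left_mono; simp)+
  thus ?thesis by (simp add: field_simps)
qed

lemma affine_substitution:
  fixes F :: "real \<Rightarrow> 'a :: euclidean_space" and a b :: real
  defines "c \<equiv> (a + b) / 2" and "h \<equiv> (b - a) / 2"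
  assumes ab: "a < b" and F: "F absolutely_integrable_on {a..b}" and x: "x \<in> {-1..1}"
  shows "(\<lambda>t. h *\<^sub>R F (c + h * t)) absolutely_integrable_on {-1..x}"
    and "integral {-1..x} (\<lambda>t. h *\<^sub>R F (c + h * t)) = integral {a..c + h * x} F"
proof -
  have h: "h > 0" using ab by (simp add: h_def)
  have le: "a \<le> c + h * x" "c + h * x \<le> b"
    using affine_in_Icc[OF ab x] by (simp_all add: c_def h_def)
  have img: "(\<lambda>t. c + h * t) ` {-1..x} = {a..c + h * x}"
  proof -
    have "(\<lambda>t. c + h * t) ` {-1..x} = (\<lambda>t. h * t + c) ` {-1..x}" by (simp add: add.commute)
    also have "\<dots> = {h * (-1) + c..h * x + c}"
      using h x by (subst image_affinity_atLeastAtMost) auto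
    also have "h * (-1) + c = a" by (simp add: c_def h_def field_simps)
    finally show ?thesis by (simp add: add.commute)
  qed
  have der: "((\<lambda>t. c + h * t) has_field_derivative h) (at t within {-1..x})" for t
    by (auto intro!: derivative_eq_intros)
  have inj: "inj_on (\<lambda>t. c + h * t) {-1..x}" using h by (auto simp: inj_on_def)
  have "F absolutely_integrable_on {a..c + h * x}"
    using F by (rule absolutely_integrable_on_subinterval) (use le in auto)
  hence "(\<lambda>t. \<bar>h\<bar> *\<^sub>R F (c + h * t)) absolutely_integrable_on {-1..x} \<and>
     integral {-1..x} (\<lambda>t. \<bar>h\<bar> *\<^sub>R F (c + h * t)) = integral {a..c + h * x} F"
    by (subst has_absolute_integral_change_of_variables_real[OF _ der inj]) (simp_all add: img)
  thus "(\<lambda>t. h *\<^sub>R F (c + h * t)) absolutely_integrable_on {-1..x}"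
    and "integral {-1..x} (\<lambda>t. h *\<^sub>R F (c + h * t)) = integral {a..c + h * x} F"
    using h by simp_all
qed

lemma is_primitive_scale:
  assumes "is_primitive a b f u"
  shows "is_primitive a b (\<lambda>x. s * f x) (\<lambda>x. s * u x)"
  unfolding is_primitive_def
proof (intro conjI ballI)
  show "(\<lambda>x. s * u x) absolutely_integrable_on {a..b}"
    by (rule absolutely_integrable_continuous_mult[OF continuous_on_const is_primitiveD(1)[OF assms]])
  fix x assume x: "x \<in> {a..b}"
  have "s * f x = s * (f a + integral {a..x} u)" by (subst is_primitiveD(2)[OF assms x]) (rule refl)
  thus "s * f x = s * f a + integral {a..x} (\<lambda>x. s * u x)" by (simp add: distrib_left)
qed

lemma is_deriv_scale: "is_deriv a b m f g \<Longrightarrow> is_deriv a b m (\<lambda>x. s * f x) (\<lambda>x. s * g x)"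
proof (induction m arbitrary: f)
  case (Suc m)
  then obtain u where "is_primitive a b f u" "is_deriv a b m u g" unfolding is_deriv_Suc_iff by blast
  thus ?case unfolding is_deriv_Suc_iff
    by (intro exI[of _ "\<lambda>x. s * u x"] conjI is_primitive_scale Suc.IH)
qed simp

lemma is_primitive_affine:
  fixes a b :: real
  defines "c \<equiv> (a + b) / 2" and "h \<equiv> (b - a) / 2"
  assumes ab: "a < b" and f: "is_primitive a b f u"
  shows "is_primitive (-1) 1 (\<lambda>t. f (c + h * t)) (\<lambda>t. of_real h * u (c + h * t))"
  unfolding is_primitive_def
proof (intro conjI ballI)
  note sub = affine_substitution[OF ab is_primitiveD(1)[OF f], folded c_def h_def]
  show "(\<lambda>t. of_real h * u (c + h * t)) absolutely_integrable_on {-1..1}"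
    using sub(1)[of 1] by (simp add: scaleR_conv_of_real)
  fix x :: real assume x: "x \<in> {-1..1}"
  have ca: "c + h * (-1) = a" by (simp add: c_def h_def field_simps)
  have "f (c + h * x) - f a = integral {a..c + h * x} u"
    using is_primitive_increment(1)[OF f, of a "c + h * x"] affine_in_Icc[OF ab x] by (simp add: c_def h_def)
  thus "f (c + h * x) = f (c + h * (-1)) + integral {-1..x} (\<lambda>t. of_real h * u (c + h * t))"
    unfolding ca using sub(2)[OF x] by (simp add: scaleR_conv_of_real algebra_simps)
qed

lemma is_deriv_affine:
  fixes a b :: real
  defines "c \<equiv> (a + b) / 2" and "h \<equiv> (b - a) / 2"
  assumes ab: "a < b"
  shows "is_deriv a b m f g \<Longrightarrow> is_deriv (-1) 1 m (\<lambda>t. f (c + h * t)) (\<lambda>t. of_real h ^ m * g (c + h * t))"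
proof (induction m arbitrary: f)
  case 0
  have "c + h * x \<in> {a..b}" if "x \<in> {-1..1}" for x
    using affine_in_Icc[OF ab that] by (simp add: c_def h_def)
  thus ?case using 0 by simp
next
  case (Suc m)
  then obtain u where u: "is_primitive a b f u" "is_deriv a b m u g" unfolding is_deriv_Suc_iff by blast
  have "is_deriv (-1) 1 m (\<lambda>t. of_real h * u (c + h * t)) (\<lambda>t. of_real h * (of_real h ^ m * g (c + h * t)))"
    by (rule is_deriv_scale[OF Suc.IH[OF u(2)]])
  thus ?case unfolding is_deriv_Suc_iff power_Suc mult.assoc
    using is_primitive_affine[OF ab u(1), folded c_def h_def] by blast
qed

text \<open>For \<open>m = 0\<close> this is not part of the definition of \<open>Hw\<close>, but follows from square
  integrability because the weight is at least \<open>1 / (b - a)\<close>.\<close>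

lemma Hw_absolutely_integrable:
  assumes ab: "a < b" and f: "f \<in> Hw a b m"
  shows "nth_derivative a b m f absolutely_integrable_on {a..b}" "f absolutely_integrable_on {a..b}"
proof -
  define g where "g = nth_derivative a b m f"
  have d: "is_deriv a b m f g" unfolding g_def by (rule Hw_is_deriv[OF f])
  have "g absolutely_integrable_on {a..b} \<and> f absolutely_integrable_on {a..b}"
  proof (cases m)
    case 0
    let ?w = "Hw_integrand a b m f"
    \<comment> \<open>the weighted integrand vanishes at the two end points, where it says nothing about \<open>g\<close>\<close>
    define H where "H = (\<lambda>x. if x \<in> {a, b} then norm (g x) else 1 + (b - a) * ?w x)"
    have w: "?w integrable_on {a..b}" using f by (simp add: Hw_def)
    have "(\<lambda>x. 1 + (b - a) * ?w x) integrable_on {a..b}"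
      by (intro Henstock_Kurzweil_Integration.integrable_add integrable_on_mult_right w) auto
    hence "H integrable_on {a..b}"
      by (rule integrable_spike_finite[of "{a, b}", rotated 2]) (auto simp: H_def)
    moreover have "norm (g x) \<le> H x" if x: "x \<in> {a..b}" for x
    proof (cases "x \<in> {a, b}")
      case False
      hence x': "a < x" "x < b" using x by auto
      have "sqrt ((b - x) * (x - a)) \<le> sqrt ((b - a) * (b - a))"
        using x' by (intro real_sqrt_le_mono mult_mono) auto
      hence s: "sqrt ((b - x) * (x - a)) \<le> b - a" "sqrt ((b - x) * (x - a)) > 0" using x' by auto
      have "(norm (g x))\<^sup>2 = sqrt ((b - x) * (x - a)) * ?w x"
        using s(2) unfolding Hw_integrand_def g_def by (metis less_irrefl nonzero_mult_div_cancel_left times_divide_eq_right)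
      also have "\<dots> \<le> (b - a) * ?w x"
        using s(1) x' by (intro mult_right_mono) (auto simp: Hw_integrand_def)
      finally have "(norm (g x))\<^sup>2 \<le> (b - a) * ?w x" .
      moreover have "norm (g x) \<le> 1 + (norm (g x))\<^sup>2"
        using zero_le_power2[of "norm (g x) - 1"] norm_ge_zero[of "g x"]
        unfolding power2_diff one_power2 mult_1_right by linarith
      ultimately show ?thesis using False by (simp add: H_def)
    qed (simp add: H_def)
    moreover have "g \<in> borel_measurable (lebesgue_on {a..b})" using f by (simp add: Hw_def g_def)
    ultimately have g: "g absolutely_integrable_on {a..b}"
      by (intro measurable_bounded_by_integrable_imp_absolutely_integrable[where g = H]) auto
    moreover have "f absolutely_integrable_on {a..b}"
      using d 0 by (intro absolutely_integrable_spike[OF g, of "{}"]) auto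
    ultimately show ?thesis ..
  next
    case (Suc n)
    obtain u where "is_primitive a b f u" using d unfolding Suc is_deriv_Suc_iff by blast
    hence "f absolutely_integrable_on {a..b}"
      by (intro absolutely_integrable_continuous_real is_primitive_continuous)
    thus ?thesis using is_deriv_absolutely_integrable[OF d[unfolded Suc]] by simp
  qed
  thus "nth_derivative a b m f absolutely_integrable_on {a..b}" "f absolutely_integrable_on {a..b}"
    by (simp_all add: g_def)
qed

text \<open>Each derivative brings a factor \<open>h\<close>. The weight is homogeneous of degree \<open>-1\<close> and the
  Jacobian of degree \<open>1\<close>, so they leave no further power of \<open>h\<close>.\<close>

lemma Hw_affine:
  fixes a b :: real
  defines "c \<equiv> (a + b) / 2" and "h \<equiv> (b - a) / 2"
  assumes ab: "a < b" and f: "f \<in> Hw a b m"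
  shows "(\<lambda>t. f (c + h * t)) \<in> Hw (-1) 1 m"
    and "Hw_seminorm (-1) 1 m (\<lambda>t. f (c + h * t)) = h ^ m * Hw_seminorm a b m f"
proof -
  have h: "h > 0" using ab by (simp add: h_def)
  have c1: "c + h * 1 = b" and cm: "c - h = a" by (simp_all add: c_def h_def field_simps)
  define F where "F = (\<lambda>t. f (c + h * t))"
  define g where "g = nth_derivative a b m f"
  define G where "G = nth_derivative (-1) 1 m F"
  define G0 where "G0 = (\<lambda>t. of_real h ^ m * g (c + h * t))"
  have d0: "is_deriv (-1) 1 m F G0"
    using is_deriv_affine[OF ab Hw_is_deriv[OF f]] by (simp add: F_def G0_def g_def c_def h_def)
  have dG: "is_deriv (-1) 1 m F G"
    unfolding G_def nth_derivative_def by (rule someI[of "is_deriv (-1) 1 m F", OF d0])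
  have n: "negligible {t \<in> {-1..1}. G t \<noteq> G0 t}"
    by (rule is_deriv_unique[OF dG d0]) simp
  have "(\<lambda>t. h *\<^sub>R g (c + h * t)) absolutely_integrable_on {-1..1}"
    using affine_substitution(1)[OF ab Hw_absolutely_integrable(1)[OF ab f], of 1] by (simp add: c_def h_def g_def)
  from absolutely_integrable_continuous_mult[OF continuous_on_const[of _ "of_real h ^ m / of_real h"] this]
  have "G0 absolutely_integrable_on {-1..1}"
    using h by (simp add: G0_def scaleR_conv_of_real)
  hence Gabs: "G absolutely_integrable_on {-1..1}"
    by (rule absolutely_integrable_spike[OF _ n]) auto
  let ?w = "Hw_integrand a b m f"
  have wint: "?w integrable_on {a..b}" using f by (simp add: Hw_def)
  have wabs: "?w absolutely_integrable_on {a..b}"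
    by (rule nonnegative_absolutely_integrable_1[OF wint]) (auto simp: Hw_integrand_def)
  note sub = affine_substitution[OF ab wabs, of 1, folded c_def h_def]
  have eq: "Hw_integrand (-1) 1 m F t = (h ^ m)\<^sup>2 * (h *\<^sub>R ?w (c + h * t))" if "t \<in> {-1..1} - {t \<in> {-1..1}. G t \<noteq> G0 t}" for t
  proof -
    have "G t = G0 t" using that by auto
    moreover have "(b - (c + h * t)) * (c + h * t - a) = h\<^sup>2 * ((1 - t) * (t - (-1)))"
      unfolding c1[symmetric] cm[symmetric] by (simp add: power2_eq_square algebra_simps)
    ultimately show ?thesis
      using h by (simp add: Hw_integrand_def G_def[symmetric] g_def[symmetric] G0_def norm_mult norm_power 
         power_mult_distrib real_sqrt_mult)
  qed
  have i: "(\<lambda>t. (h ^ m)\<^sup>2 * (h *\<^sub>R ?w (c + h * t))) integrable_on {-1..1}"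
    using sub(1) by (intro integrable_on_mult_right) (auto simp: absolutely_integrable_on_def)
  have "Hw_integrand (-1) 1 m F integrable_on {-1..1}"
    using integrable_spike[OF i n] eq by blast
  moreover have "G \<in> borel_measurable (lebesgue_on {-1..1})"
    using Gabs by (intro absolutely_integrable_imp_borel_measurable) auto
  ultimately show "(\<lambda>t. f (c + h * t)) \<in> Hw (-1) 1 m"
    using dG unfolding F_def[symmetric] Hw_def G_def by blast
  have "integral {-1..1} (Hw_integrand (-1) 1 m F) = integral {-1..1} (\<lambda>t. (h ^ m)\<^sup>2 * (h *\<^sub>R ?w (c + h * t)))"
    by (rule integral_spike[OF n]) (use eq in auto)
  also have "\<dots> = (h ^ m)\<^sup>2 * integral {a..b} ?w"
    using sub(2) c1 by simp
  finally show "Hw_seminorm (-1) 1 m (\<lambda>t. f (c + h * t)) = h ^ m * Hw_seminorm a b m f"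
    unfolding F_def[symmetric] Hw_seminorm_def using h by (simp add: real_sqrt_mult)
qed

lemma fcc_error_affine:
  fixes a b :: real
  defines "c \<equiv> (a + b) / 2" and "h \<equiv> (b - a) / 2"
  assumes ab: "a < b" and f: "f \<in> Hw a b m"
  shows "norm (osc_integral a b k f - fcc a b k N f) =
     h * norm (osc_integral (-1) 1 (h * k) (\<lambda>t. f (c + h * t)) - fcc_ref (h * k) N (\<lambda>t. f (c + h * t)))"
proof -
  have h: "h > 0" using ab by (simp add: h_def)
  have c1: "c + h * 1 = b" by (simp add: c_def h_def field_simps)
  have "(\<lambda>x. exp (\<i> * of_real (k * x)) * f x) absolutely_integrable_on {a..b}"
    by (intro absolutely_integrable_continuous_mult continuous_intros Hw_absolutely_integrable(2)[OF ab f])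
  hence "integral {-1..1} (\<lambda>t. h *\<^sub>R (exp (\<i> * of_real (k * (c + h * t))) * f (c + h * t))) = 
     integral {a..b} (\<lambda>x. exp (\<i> * of_real (k * x)) * f x)"
    using affine_substitution(2)[OF ab, of "\<lambda>x. exp (\<i> * of_real (k * x)) * f x" 1] c1 by (simp add: c_def h_def)
  hence "osc_integral a b k f = integral {-1..1} (\<lambda>t. h *\<^sub>R (exp (\<i> * of_real (k * (c + h * t))) * f (c + h * t)))"
    by (simp add: osc_integral_def mult.commute)
  also have "\<dots> = of_real h * exp (\<i> * of_real (k * c)) * osc_integral (-1) 1 (h * k) (\<lambda>t. f (c + h * t))"
    unfolding osc_integral_def integral_mult_right[symmetric]
    by (rule integral_cong) (simp add: scaleR_conv_of_real distrib_left exp_add mult_ac)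
  finally have "osc_integral a b k f - fcc a b k N f = of_real h * exp (\<i> * of_real (k * c)) * 
     (osc_integral (-1) 1 (h * k) (\<lambda>t. f (c + h * t)) - fcc_ref (h * k) N (\<lambda>t. f (c + h * t)))"
    by (simp add: fcc_def Let_def c_def h_def algebra_simps)
  thus ?thesis using h by (simp add: norm_mult)
qed

lemma fcc_bound_from_reference:
  assumes ab: "a < b" and k: "0 < k" and f: "f \<in> Hw a b m"
    and bound: "fcc_ref_bound r m N ((b - a) / 2 * k) \<sigma>'"
  shows "norm (osc_integral a b k f - fcc a b k N f)
             \<le> \<sigma>' * (1 / k) powr r * ((b - a) / 2) powr (real m + 1 - r)
                 * (1 / real N) powr (real m - rho r) * Hw_seminorm a b m f"
proof -
  define c where "c = (a + b) / 2"
  define h where "h = (b - a) / 2"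
  have h: "h > 0" using ab by (simp add: h_def)
  note aff = Hw_affine[OF ab f, folded c_def h_def]
  have "norm (osc_integral a b k f - fcc a b k N f) \<le> 
      h * (\<sigma>' * (1 / (h * k)) powr r * (1 / real N) powr (real m - rho r) * Hw_seminorm (-1) 1 m (\<lambda>t. f (c + h * t)))"
    unfolding fcc_error_affine[OF ab f, folded c_def h_def]
    using bound[unfolded fcc_ref_bound_def, folded h_def] aff(1) h by (intro mult_left_mono) auto
  also have "\<dots> = \<sigma>' * ((1 / (h * k)) powr r * h * h ^ m) * (1 / real N) powr (real m - rho r) * Hw_seminorm a b m f"
    unfolding aff(2) by (simp add: mult_ac)
  also have "(1 / (h * k)) powr r * h * h ^ m = (1 / k) powr r * h powr (real m + 1 - r)"
  proof -
    have "h powr (real m + 1 - r) = h ^ m * h * h powr (- r)"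
      using h by (simp add: powr_add powr_diff powr_minus_divide powr_realpow)
    moreover have "(1 / (h * k)) powr r = (1 / k) powr r * h powr (- r)"
      using h k by (simp add: powr_divide powr_mult powr_minus_divide)
    ultimately show ?thesis by (simp add: mult_ac)
  qed
  finally show ?thesis by (simp add: h_def mult_ac)
qed

theorem theorem2p6:
  shows
    "(\<exists>C>0. \<forall>(r::real) (N::nat) (m::nat) (a::real) (b::real) (k::real) (f::real \<Rightarrow> complex).
         0 \<le> r \<and> r \<le> 2 \<and> 1 \<le> N \<and> m \<le> N + 1 \<and> a < b \<and> 0 < k \<and> f \<in> Hw a b m \<and>
         1 \<le> m \<and> r \<le> real m \<and> 1/2 \<le> (b - a) / 2 * k \<longrightarrow>
           norm (osc_integral a b k f - fcc a b k N f)
             \<le> (C * fcc_sigma m N) * (1 / k) powr r * ((b - a) / 2) powr (real m + 1 - r)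
                 * (1 / real N) powr (real m - rho r) * Hw_seminorm a b m f)
     \<and>
     (\<forall>(\<sigma>'::real) (r::real) (N::nat) (m::nat) (a::real) (b::real) (k::real) (f::real \<Rightarrow> complex).
         0 \<le> r \<and> r \<le> 2 \<and> 1 \<le> N \<and> m \<le> N + 1 \<and> a < b \<and> 0 < k \<and> f \<in> Hw a b m \<and>
         fcc_ref_bound r m N ((b - a) / 2 * k) \<sigma>' \<longrightarrow>
           norm (osc_integral a b k f - fcc a b k N f)
             \<le> \<sigma>' * (1 / k) powr r * ((b - a) / 2) powr (real m + 1 - r)
                 * (1 / real N) powr (real m - rho r) * Hw_seminorm a b m f)"
proof
  show "\<exists>C>0. \<forall>(r::real) (N::nat) (m::nat) (a::real) (b::real) (k::real) (f::real \<Rightarrow> complex).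
         0 \<le> r \<and> r \<le> 2 \<and> 1 \<le> N \<and> m \<le> N + 1 \<and> a < b \<and> 0 < k \<and> f \<in> Hw a b m \<and>
         1 \<le> m \<and> r \<le> real m \<and> 1/2 \<le> (b - a) / 2 * k \<longrightarrow>
           norm (osc_integral a b k f - fcc a b k N f)
             \<le> (C * fcc_sigma m N) * (1 / k) powr r * ((b - a) / 2) powr (real m + 1 - r)
                 * (1 / real N) powr (real m - rho r) * Hw_seminorm a b m f"
    by (intro exI[of _ 32] conjI allI impI, simp)
       (elim conjE, intro fcc_bound_from_reference fcc_ref_bound_explicit; assumption)
qed (intro allI impI, elim conjE, rule fcc_bound_from_reference)

end
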